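(* Let $n$ and $k$ be natural numbers with $k \geqslant 5$ and $n \geqslant 2(k-1)$, and let $G$ be one of $\mathrm{Aut}^{+}(F_n)$, $\mathrm{Out}^{+}(F_n)$, $\mathrm{SL}(n,\mathbb{Z})$. Then $G$ is generated by finitely many elements of order $k$ and $d_k(G) \leqslant 6$. If in addition $k \geqslant 6$ and $n \geqslant 2k$, then $d_k(G) \leqslant 5$.
   Context: $F_n$ is the free group of rank $n$. The abelianization $F_n \to F_n/[F_n,F_n]\cong \mathbb{Z}^n$ induces a homomorphism $\mathrm{Aut}(F_n)\to \mathrm{GL}(n,\mathbb{Z})$; $\mathrm{Aut}^{+}(F_n)$ is the preimage of $\mathrm{SL}(n,\mathbb{Z})$. Similarly, $\mathrm{Out}(F_n)=\mathrm{Aut}(F_n)/\mathrm{Inn}(F_n)$ maps to $\mathrm{GL}(n,\mathbb{Z})$, and $\mathrm{Out}^{+}(F_n)$ is the preimage of $\mathrm{SL}(n,\mathbb{Z})$. For a positive integer $k$ and a group $G$ generated by finitely many elements of order $k$, $d_k(G)$ denotes the smallest cardinality of a generating set of $G$ all of whose elements have order exactly $k$. *)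

theory Defs
  imports "Jordan_Normal_Form.Determinant" "HOL-Algebra.Bij" "HOL-Algebra.Coset"
          "HOL-Algebra.Generated_Groups" "HOL-Algebra.Multiplicative_Group"
begin

text \<open>A letter (i, True) is the generator x_i, (i, False) is its inverse.\<close>
type_synonym letter = "nat \<times> bool"

definition inv_letter :: "letter \<Rightarrow> letter" where
  "inv_letter l = (fst l, \<not> snd l)"

fun reduced :: "letter list \<Rightarrow> bool" where
  "reduced [] = True"
| "reduced [x] = True"
| "reduced (x # y # ys) = (y \<noteq> inv_letter x \<and> reduced (y # ys))"

fun push :: "letter \<Rightarrow> letter list \<Rightarrow> letter list" where
  "push x [] = [x]"
| "push x (y # ys) = (if y = inv_letter x then ys else x # y # ys)"

definition free_group :: "nat \<Rightarrow> letter list monoid" where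
  "free_group n =
    \<lparr>carrier = {w. reduced w \<and> (\<forall>l \<in> set w. fst l < n)},
     mult = (\<lambda>w v. foldr push w v),
     one = []\<rparr>"

definition Aut_F :: "nat \<Rightarrow> (letter list \<Rightarrow> letter list) monoid" where
  "Aut_F n = AutoGroup (free_group n)"

definition Inn_F :: "nat \<Rightarrow> (letter list \<Rightarrow> letter list) set" where
  "Inn_F n = {(\<lambda>x \<in> carrier (free_group n).
                 g \<otimes>\<^bsub>free_group n\<^esub> x \<otimes>\<^bsub>free_group n\<^esub> inv\<^bsub>free_group n\<^esub> g)
              | g. g \<in> carrier (free_group n)}"

definition Out_F :: "nat \<Rightarrow> (letter list \<Rightarrow> letter list) set monoid" where
  "Out_F n = Aut_F n Mod Inn_F n"

text \<open>Exponent sum of generator i in a word: the image of the word in Z^n, coordinate i.\<close>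
definition expsum :: "nat \<Rightarrow> letter list \<Rightarrow> int" where
  "expsum i w = (\<Sum>l\<leftarrow>w. if fst l = i then (if snd l then 1 else -1) else 0)"

text \<open>The matrix in GL(n,Z) induced by an automorphism on the abelianisation
  (column j is the image of the basis vector e_j).\<close>
definition ab_mat :: "nat \<Rightarrow> (letter list \<Rightarrow> letter list) \<Rightarrow> int mat" where
  "ab_mat n \<phi> = mat n n (\<lambda>(i, j). expsum i (\<phi> [(j, True)]))"

definition Aut_plus :: "nat \<Rightarrow> (letter list \<Rightarrow> letter list) monoid" where
  "Aut_plus n = (Aut_F n)\<lparr>carrier := {\<phi> \<in> carrier (Aut_F n). det (ab_mat n \<phi>) = 1}\<rparr>"

text \<open>Preimage of SL(n,Z) in Out(F_n); the map Out(F_n) \<rightarrow> GL(n,Z) sends a coset to the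
  common matrix of its elements.\<close>
definition Out_plus :: "nat \<Rightarrow> (letter list \<Rightarrow> letter list) set monoid" where
  "Out_plus n = (Out_F n)\<lparr>carrier :=
     {C \<in> carrier (Out_F n). \<forall>\<phi> \<in> C. det (ab_mat n \<phi>) = 1}\<rparr>"

definition SL_Z :: "nat \<Rightarrow> int mat monoid" where
  "SL_Z n = \<lparr>carrier = {A \<in> carrier_mat n n. det A = 1}, mult = (*), one = 1\<^sub>m n\<rparr>"

definition order_k_gensets :: "('a, 'b) monoid_scheme \<Rightarrow> nat \<Rightarrow> 'a set set" where
  "order_k_gensets G k = {S. S \<subseteq> carrier G \<and> finite S \<and> (\<forall>x \<in> S. group.ord G x = k)
                              \<and> generate G S = carrier G}"

definition gen_by_order :: "('a, 'b) monoid_scheme \<Rightarrow> nat \<Rightarrow> bool" where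
  "gen_by_order G k \<longleftrightarrow> order_k_gensets G k \<noteq> {}"

definition d_k :: "nat \<Rightarrow> ('a, 'b) monoid_scheme \<Rightarrow> nat" where
  "d_k k G = (LEAST m. \<exists>S \<in> order_k_gensets G k. card S = m)"

end

theory Submission
  imports Defs "HOL-Library.Sublist"
begin

text \<open>
  Five elements suffice for every \<open>k \<ge> 5\<close>. Modulo Nielsen's theorem (the elementary transvections
  \<open>x\<^sub>i \<mapsto> x\<^sub>i x\<^sub>j\<^sup>\<plusminus>\<^sup>1\<close>, \<open>x\<^sub>i \<mapsto> x\<^sub>j\<^sup>\<plusminus>\<^sup>1 x\<^sub>i\<close> generate the automorphisms of determinant one) it is enough to
  produce all transvections. Let \<open>a\<close> be a \<open>k\<close>-cycle on the last \<open>k\<close> generators \<open>p\<^sub>0, \<dots>, p\<^sub>k\<^sub>-\<^sub>1\<close>, and let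
  \<open>b\<close>, \<open>c\<close> be products of consecutive \<open>k\<close>-cycles, starting at the first and at the second generator;
  if such an element has determinant \<open>-1\<close>, then \<open>k\<close> is even and one inverts a fixed generator as well.
  With \<open>z = x\<^sub>0\<close>, \<open>w = x\<^sub>1\<close>, \<open>\<tau> : z \<mapsto> p\<^sub>2\<^sup>-\<^sup>1 z p\<^sub>0\<close> and \<open>\<sigma> : p\<^sub>0 \<mapsto> w\<^sup>-\<^sup>1 p\<^sub>0\<close>, the other two elements are the
  conjugates of \<open>a\<close> by \<open>\<tau>\<close> and \<open>\<sigma>\<close>. The quotient of the first by \<open>a\<close> is
  \<open>z \<mapsto> (p\<^sub>2 p\<^sub>3\<^sup>-\<^sup>1)\<^sup>-\<^sup>1 z (p\<^sub>0 p\<^sub>1\<^sup>-\<^sup>1)\<close>; the quotient of the second, conjugated by powers of \<open>a\<close>, multiplies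
  two cyclically adjacent \<open>p\<^sub>i\<close> by powers of \<open>w\<close>. Since \<open>k \<ge> 5\<close>, one can let it move only \<open>p\<^sub>0\<close> or only \<open>p\<^sub>3\<close>
  among \<open>p\<^sub>0, \<dots>, p\<^sub>3\<close>, and the commutators are the transvections of \<open>z\<close> by \<open>w\<close> on either side. Conjugation by
  \<open>a, b, c\<close> and the commutator relation spread them to all pairs of generators. The images of the five
  elements in \<open>SL(n, \<int>)\<close> still have order \<open>k\<close>, so the result passes to the quotients.
\<close>

section \<open>The free group\<close>

lemma inv_letter_simps [simp]:
  "inv_letter (inv_letter l) = l" "fst (inv_letter l) = fst l" "inv_letter l \<noteq> l" "l \<noteq> inv_letter l"
  "inv_letter l = inv_letter m \<longleftrightarrow> l = m"
  by (auto simp: inv_letter_def prod_eq_iff)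

lemma inv_letter_pair [simp]: "inv_letter (i, b) = (i, \<not> b)"
  by (simp add: inv_letter_def)

lemma fst_eq_cases: "fst l = fst m \<Longrightarrow> l = m \<or> l = inv_letter m"
  by (auto simp: inv_letter_def prod_eq_iff)

section \<open>Inverse words, and letters acting on reduced words\<close>

definition winv :: "letter list \<Rightarrow> letter list" where
  "winv w = rev (map inv_letter w)"

lemma winv_simps [simp]:
  "winv [] = []" "winv (u @ v) = winv v @ winv u" "winv [l] = [inv_letter l]"
  "winv (winv w) = w" "length (winv w) = length w" "winv w = [] \<longleftrightarrow> w = []"
  by (auto simp: winv_def rev_map o_def)

lemma winv_Cons: "winv (l # w) = winv w @ [inv_letter l]"
  by (simp add: winv_def)

lemma fst_set_winv [simp]: "fst ` set (winv w) = fst ` set w"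
  by (auto simp: winv_def image_image)

lemma reduced_Cons:
  "reduced (x # w) \<longleftrightarrow> reduced w \<and> (w \<noteq> [] \<longrightarrow> hd w \<noteq> inv_letter x)"
  by (cases w) auto

lemma reduced_append:
  "reduced (u @ v) \<longleftrightarrow> reduced u \<and> reduced v \<and>
     (u \<noteq> [] \<longrightarrow> v \<noteq> [] \<longrightarrow> hd v \<noteq> inv_letter (last u))"
  by (induction u) (auto simp: reduced_Cons)

lemma reduced_winv [simp]: "reduced (winv w) \<longleftrightarrow> reduced w"
proof -
  have "reduced (winv w)" if "reduced w" for w
    using that
  proof (induction w)
    case (Cons x w)
    then show ?case
      by (cases w) (auto simp: winv_Cons reduced_append)
  qed simp
  from this[of w] this[of "winv w"] show ?thesis by auto
qed

lemma set_winv: "set (winv w) = inv_letter ` set w"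
  by (simp add: winv_def)

lemma push_reduced: "reduced (x # w) \<Longrightarrow> push x w = x # w"
  by (cases w) simp_all

lemma reduced_push: "reduced w \<Longrightarrow> reduced (push x w)"
  by (cases w) (auto simp: reduced_Cons)

text \<open>Every letter thus acts on the reduced words by a permutation. This is van der Waerden's
  route to associativity, which avoids any confluence argument for cancellation.\<close>

lemma push_push_inv: "reduced w \<Longrightarrow> push x (push (inv_letter x) w) = w"
  by (cases w) (simp_all, metis inv_letter_simps(1) push_reduced)

lemma reduced_foldr_push: "reduced v \<Longrightarrow> reduced (foldr push u v)"
  by (induction u) (auto simp: reduced_push)

lemma foldr_push_push:
  assumes "reduced v"
  shows "foldr push (push x w) v = push x (foldr push w v)"
  using assms by (cases w) (auto simp: push_push_inv reduced_foldr_push)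

text \<open>Multiplication by a word is the composite of the pushes of its letters, and
  \<open>foldr_push_push\<close> says that cancelling a letter does not change this
  composite.\<close>

lemma foldr_push_assoc:
  "reduced v \<Longrightarrow> foldr push (foldr push u w) v = foldr push u (foldr push w v)"
  by (induction u) (simp_all add: foldr_push_push)

lemma foldr_push_append: "reduced (u @ v) \<Longrightarrow> foldr push u v = u @ v"
proof (induction u)
  case (Cons x u)
  then show ?case
    by (metis append_Cons foldr_Cons comp_apply push_reduced reduced_Cons)
qed simp

lemma set_push: "set (push x w) \<subseteq> insert x (set w)"
  by (cases w) auto

lemma set_foldr_push: "set (foldr push u v) \<subseteq> set u \<union> set v"
  by (induction u) (use set_push in fastforce)+

lemma foldr_push_winv: "reduced w \<Longrightarrow> foldr push (winv w) w = []"
proof (induction w)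
  case (Cons x w)
  then show ?case
    by (simp add: winv_Cons reduced_Cons)
qed simp

lemma group_free_group: "group (free_group n)"
proof (rule groupI)
  fix x y z assume x: "x \<in> carrier (free_group n)" and y: "y \<in> carrier (free_group n)"
    and z: "z \<in> carrier (free_group n)"
  show "x \<otimes>\<^bsub>free_group n\<^esub> y \<in> carrier (free_group n)"
    using x y set_foldr_push[of x y] by (auto simp: free_group_def reduced_foldr_push)
  show "x \<otimes>\<^bsub>free_group n\<^esub> y \<otimes>\<^bsub>free_group n\<^esub> z =
    x \<otimes>\<^bsub>free_group n\<^esub> (y \<otimes>\<^bsub>free_group n\<^esub> z)"
    using z by (simp add: free_group_def foldr_push_assoc)
next
  fix x assume x: "x \<in> carrier (free_group n)"
  then have "winv x \<in> carrier (free_group n)"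
    by (auto simp: free_group_def set_winv)
  then show "\<exists>y\<in>carrier (free_group n). y \<otimes>\<^bsub>free_group n\<^esub> x = \<one>\<^bsub>free_group n\<^esub>"
    using x by (intro bexI[of _ "winv x"]) (auto simp: free_group_def foldr_push_winv)
qed (auto simp: free_group_def)

lemma group_Aut_F: "group (Aut_F n)"
  unfolding Aut_F_def by (rule group.AutoGroup[OF group_free_group])

locale free_group_rank =
  fixes n :: nat
begin

abbreviation F where "F \<equiv> free_group n"
abbreviation A where "A \<equiv> Aut_F n"

sublocale F: group F by (rule group_free_group)
sublocale A: group A by (rule group_Aut_F)

abbreviation wmult (infixl \<open>\<cdot>\<close> 70) where "u \<cdot> v \<equiv> u \<otimes>\<^bsub>F\<^esub> v"
abbreviation amult (infixl \<open>\<diamondop>\<close> 70) where "f \<diamondop> g \<equiv> f \<otimes>\<^bsub>A\<^esub> g"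
abbreviation winvF where "winvF u \<equiv> inv\<^bsub>F\<^esub> u"

lemma mem_F: "w \<in> carrier F \<longleftrightarrow> reduced w \<and> (\<forall>l\<in>set w. fst l < n)"
  by (simp add: free_group_def)

lemma F_mult: "u \<cdot> v = foldr push u v"
  by (simp add: free_group_def)

lemma F_one [simp]: "\<one>\<^bsub>F\<^esub> = []"
  by (simp add: free_group_def)

lemma F_Nil [simp]: "[] \<in> carrier F"
  by (simp add: mem_F)

lemma F_mult_Nil [simp]: "u \<in> carrier F \<Longrightarrow> u \<cdot> [] = u" "u \<in> carrier F \<Longrightarrow> [] \<cdot> u = u"
  using F.r_one F.l_one by simp_all

lemma F_inv_cancel [simp]:
  "u \<in> carrier F \<Longrightarrow> u \<cdot> winvF u = []" "u \<in> carrier F \<Longrightarrow> winvF u \<cdot> u = []"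
  using F.r_inv F.l_inv by simp_all

lemma F_inv_cancel' [simp]:
  assumes "u \<in> carrier F" "v \<in> carrier F"
  shows "u \<cdot> (winvF u \<cdot> v) = v" "winvF u \<cdot> (u \<cdot> v) = v"
  using assms by (simp_all flip: F.m_assoc)

lemma letter_mem [simp]: "[l] \<in> carrier F \<longleftrightarrow> fst l < n"
  by (simp add: mem_F)

lemma winv_mem: "w \<in> carrier F \<Longrightarrow> winv w \<in> carrier F"
  by (auto simp: mem_F set_winv)

lemma F_inv: "w \<in> carrier F \<Longrightarrow> winvF w = winv w"
  by (rule F.inv_equality) (simp_all add: F_mult foldr_push_winv winv_mem, simp add: mem_F foldr_push_winv)

lemma F_inv_Nil [simp]: "winvF [] = []"
  using F.inv_one by simp

lemma F_inv_letter [simp]: "fst l < n \<Longrightarrow> winvF [l] = [inv_letter l]"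
  by (simp add: F_inv)

lemma F_Cons: "l # w \<in> carrier F \<Longrightarrow> l # w = [l] \<cdot> w \<and> fst l < n \<and> w \<in> carrier F"
  by (simp add: mem_F F_mult push_reduced) (simp add: reduced_Cons)

section \<open>Homomorphisms and the universal property\<close>

lemma hom_mult: "h \<in> hom F F \<Longrightarrow> u \<in> carrier F \<Longrightarrow> v \<in> carrier F \<Longrightarrow> h (u \<cdot> v) = h u \<cdot> h v"
  by (simp add: hom_def)

lemma hom_mem: "h \<in> hom F F \<Longrightarrow> u \<in> carrier F \<Longrightarrow> h u \<in> carrier F"
  by (auto simp: hom_def)

lemma hom_Nil: "h \<in> hom F F \<Longrightarrow> h [] = []"
  using hom_one[OF _ F.is_group F.is_group, of h] by simp

lemma hom_inv: "h \<in> hom F F \<Longrightarrow> u \<in> carrier F \<Longrightarrow> h (winvF u) = winvF (h u)"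
  using group_hom.hom_inv[of F F h] by (simp add: group_hom_def group_hom_axioms_def)

lemma hom_inv_letter: "h \<in> hom F F \<Longrightarrow> fst l < n \<Longrightarrow> h [inv_letter l] = winvF (h [l])"
  using hom_inv[of h "[l]"] by simp

lemma hom_agree:
  assumes "g \<in> hom F F" "h \<in> hom F F" "w \<in> carrier F" "\<And>l. l \<in> set w \<Longrightarrow> g [l] = h [l]"
  shows "g w = h w"
  using assms(3,4)
proof (induction w)
  case Nil
  then show ?case using assms by (simp add: hom_Nil)
next
  case (Cons l w)
  have *: "l # w = [l] \<cdot> w" "fst l < n" "w \<in> carrier F"
    using F_Cons Cons.prems by blast+
  then show ?case
    using Cons assms(1,2) by (metis hom_mult letter_mem list.set_intros)
qed

text \<open>Cancellation never creates letters, so a generator absent from the images of all letters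
  of \<open>w\<close> is absent from the image of \<open>w\<close>.\<close>

lemma hom_avoid:
  assumes "h \<in> hom F F" "w \<in> carrier F" "\<And>l. l \<in> set w \<Longrightarrow> i \<notin> fst ` set (h [l])"
  shows "i \<notin> fst ` set (h w)"
  using assms(2,3)
proof (induction w)
  case Nil
  then show ?case using assms by (simp add: hom_Nil)
next
  case (Cons l w)
  have *: "l # w = [l] \<cdot> w" "fst l < n" "w \<in> carrier F"
    using F_Cons Cons.prems by blast+
  have "h (l # w) = foldr push (h [l]) (h w)"
    using hom_mult[OF assms(1), of "[l]" w] * by (simp add: F_mult)
  moreover have "i \<notin> fst ` set (h [l])" "i \<notin> fst ` set (h w)"
    using Cons *(3) by auto
  ultimately show ?case
    using set_foldr_push[of "h [l]" "h w"] by auto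
qed

text \<open>One sign for each generator suffices, because homomorphisms commute with inversion. The
  sign may depend on the generator, so each application can choose the convenient one.\<close>

lemma hom_ext_letters:
  assumes "g \<in> hom F F" "h \<in> hom F F" "g \<in> extensional (carrier F)" "h \<in> extensional (carrier F)"
    and "\<And>i. i < n \<Longrightarrow> \<exists>b. g [(i, b)] = h [(i, b)]"
  shows "g = h"
proof (rule extensionalityI[OF assms(3,4)])
  fix w assume w: "w \<in> carrier F"
  show "g w = h w"
  proof (rule hom_agree[OF assms(1,2) w])
    fix l assume "l \<in> set w"
    then have l: "fst l < n" using w by (auto simp: mem_F)
    then obtain b where b: "g [(fst l, b)] = h [(fst l, b)]" using assms(5) by blast
    have "l = (fst l, b) \<or> l = inv_letter (fst l, b)" by (rule fst_eq_cases) simp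
    then show "g [l] = h [l]"
      using b hom_inv_letter[OF assms(1), of "(fst l, b)"] hom_inv_letter[OF assms(2), of "(fst l, b)"] l
      by auto
  qed
qed

definition compat :: "(letter \<Rightarrow> letter list) \<Rightarrow> bool" where
  "compat f \<longleftrightarrow> (\<forall>l. fst l < n \<longrightarrow> f l \<in> carrier F \<and> f (inv_letter l) = winvF (f l))"

definition endo :: "(letter \<Rightarrow> letter list) \<Rightarrow> letter list \<Rightarrow> letter list" where
  "endo f = restrict (\<lambda>w. foldr (\<lambda>l acc. f l \<cdot> acc) w []) (carrier F)"

lemma endo_ext [simp]: "endo f \<in> extensional (carrier F)"
  by (simp add: endo_def)

lemma endo_letter: "compat f \<Longrightarrow> fst l < n \<Longrightarrow> endo f [l] = f l"
  using F_mult_Nil(1)[of "f l"] by (auto simp add: endo_def compat_def split_paired_All[symmetric] simp del: F_mult_Nil split_paired_All)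

text \<open>This is the universal property. The product \<open>s\<close> of the letter images makes
  sense for every word; \<open>compat\<close> makes it respect a single cancellation, which is
  \<open>sp\<close>, and hence the multiplication.\<close>

lemma endo_hom:
  assumes "compat f"
  shows "endo f \<in> hom F F"
proof -
  define s where "s w = foldr (\<lambda>l acc. f l \<cdot> acc) w []" for w
  have s_simps: "s [] = []" "s (l # w) = f l \<cdot> s w" for l w by (auto simp: s_def)
  have fc: "f l \<in> carrier F" if "fst l < n" for l using that assms unfolding compat_def by blast
  have fi: "f (inv_letter l) = winvF (f l)" if "fst l < n" for l using that assms unfolding compat_def by blast
  have sc: "s w \<in> carrier F" if "\<forall>l\<in>set w. fst l < n" for w
    using that by (induction w) (auto simp: s_simps fc)
  have sp: "s (push l w) = f l \<cdot> s w" if "fst l < n" "\<forall>l\<in>set w. fst l < n" for l w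
    using that by (cases w) (auto simp: s_simps fc fi sc)
  have sm: "s (foldr push u v) = s u \<cdot> s v" if "\<forall>l\<in>set u. fst l < n" "\<forall>l\<in>set v. fst l < n" for u v
    using that
  proof (induction u)
    case (Cons l u)
    then show ?case
      using set_foldr_push[of u v] by (subst foldr_Cons, simp, subst sp) (auto simp: s_simps fc sc F.m_assoc)
  qed (simp add: s_simps sc)
  show ?thesis
  proof (rule homI)
    fix x y assume "x \<in> carrier F" "y \<in> carrier F"
    moreover from this have "x \<cdot> y \<in> carrier F" by simp
    ultimately show "endo f (x \<cdot> y) = endo f x \<cdot> endo f y"
      by (simp add: endo_def flip: s_def) (simp add: F_mult sm mem_F)
  next
    fix x assume "x \<in> carrier F"
    then show "endo f x \<in> carrier F"
      using sc[of x] unfolding endo_def s_def[symmetric] by (simp add: mem_F)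
  qed
qed

section \<open>Automorphisms\<close>

lemma mem_A: "\<phi> \<in> carrier A \<longleftrightarrow> \<phi> \<in> hom F F \<and> \<phi> \<in> extensional (carrier F) \<and> bij_betw \<phi> (carrier F) (carrier F)"
  by (auto simp: Aut_F_def AutoGroup_def auto_def Bij_def)

lemma A_hom [simp]: "\<phi> \<in> carrier A \<Longrightarrow> \<phi> \<in> hom F F" and A_ext: "\<phi> \<in> carrier A \<Longrightarrow> \<phi> \<in> extensional (carrier F)"
  and A_bij: "\<phi> \<in> carrier A \<Longrightarrow> bij_betw \<phi> (carrier F) (carrier F)"
  by (auto simp: mem_A)

lemma A_mem [simp]: "\<phi> \<in> carrier A \<Longrightarrow> w \<in> carrier F \<Longrightarrow> \<phi> w \<in> carrier F"
  using hom_mem A_hom by blast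

lemma A_inj: "\<phi> \<in> carrier A \<Longrightarrow> u \<in> carrier F \<Longrightarrow> v \<in> carrier F \<Longrightarrow> \<phi> u = \<phi> v \<longleftrightarrow> u = v"
  using A_bij by (auto simp: bij_betw_def inj_on_def)

lemma A_mult_eq: "\<phi> \<in> carrier A \<Longrightarrow> \<psi> \<in> carrier A \<Longrightarrow> \<phi> \<diamondop> \<psi> = compose (carrier F) \<phi> \<psi>"
  by (auto simp: Aut_F_def AutoGroup_def auto_def BijGroup_def)

lemma A_mult [simp]: "\<phi> \<in> carrier A \<Longrightarrow> \<psi> \<in> carrier A \<Longrightarrow> w \<in> carrier F \<Longrightarrow> (\<phi> \<diamondop> \<psi>) w = \<phi> (\<psi> w)"
  by (simp add: A_mult_eq compose_def)

lemma A_one: "\<one>\<^bsub>A\<^esub> = restrict (\<lambda>x. x) (carrier F)"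
  by (simp add: Aut_F_def AutoGroup_def BijGroup_def)

lemma A_one_apply [simp]: "w \<in> carrier F \<Longrightarrow> \<one>\<^bsub>A\<^esub> w = w"
  by (simp add: A_one)

lemma A_eqI:
  assumes "\<phi> \<in> carrier A" "\<psi> \<in> carrier A" "\<And>i. i < n \<Longrightarrow> \<exists>b. \<phi> [(i, b)] = \<psi> [(i, b)]"
  shows "\<phi> = \<psi>"
  using assms by (intro hom_ext_letters) (auto simp: A_ext)

text \<open>Both composites fix a letter of every generator, so they are the identity and
  \<open>endo g\<close> is the inverse of \<open>endo f\<close>.\<close>

lemma endo_A:
  assumes f: "compat f" and g: "compat g"
    and fg: "\<And>i. i < n \<Longrightarrow> \<exists>b. endo f (g (i, b)) = [(i, b)]"
    and gf: "\<And>i. i < n \<Longrightarrow> \<exists>b. endo g (f (i, b)) = [(i, b)]"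
  shows "endo f \<in> carrier A"
proof -
  note hom = endo_hom[OF f] endo_hom[OF g]
  have id: "restrict (\<lambda>x. x) (carrier F) \<in> hom F F"
    by (auto simp: hom_def)
  have cmp: "compose (carrier F) (endo p) (endo q) = restrict (\<lambda>x. x) (carrier F)"
    if "compat p" "compat q" "\<And>i. i < n \<Longrightarrow> \<exists>b. endo p (q (i, b)) = [(i, b)]" for p q
  proof (rule hom_ext_letters)
    show "compose (carrier F) (endo p) (endo q) \<in> hom F F"
      using F.hom_compose[OF endo_hom[OF that(2)] endo_hom[OF that(1)]] .
    fix i assume "i < n"
    then show "\<exists>b. compose (carrier F) (endo p) (endo q) [(i, b)] = restrict (\<lambda>x. x) (carrier F) [(i, b)]"
      using that(3)[of i] that(2) by (auto simp: compose_def endo_letter)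
  qed (use id in auto)
  have "endo f (endo g w) = w" "endo g (endo f w) = w" if "w \<in> carrier F" for w
    using fun_cong[OF cmp[OF f g fg], of w] fun_cong[OF cmp[OF g f gf], of w] that
    by (auto simp: compose_def)
  then have "bij_betw (endo f) (carrier F) (carrier F)"
    by (intro bij_betw_byWitness[where f' = "endo g"]) (use hom in \<open>auto simp: hom_def\<close>)
  then show ?thesis using hom by (simp add: mem_A)
qed

end

section \<open>Transvections and signed permutations\<close>

context free_group_rank
begin

section \<open>Transvections of one generator\<close>

definition avoids :: "letter \<Rightarrow> letter list \<Rightarrow> bool" where
  "avoids l u \<longleftrightarrow> fst l < n \<and> u \<in> carrier F \<and> fst l \<notin> fst ` set u"

lemma avoidsD: "avoids l u \<Longrightarrow> fst l < n" "avoids l u \<Longrightarrow> u \<in> carrier F"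
  by (simp_all add: avoids_def)

lemma avoids_set: "avoids l u \<Longrightarrow> x \<in> set u \<Longrightarrow> fst x < n \<and> fst x \<noteq> fst l"
  by (auto simp: avoids_def mem_F image_iff simp del: split_paired_All)

lemma avoids_inv_letter [simp]: "avoids (inv_letter l) u \<longleftrightarrow> avoids l u"
  by (simp add: avoids_def)

lemma avoids_Nil [simp]: "avoids l [] \<longleftrightarrow> fst l < n"
  by (simp add: avoids_def)

lemma avoids_letter [simp]: "avoids l [m] \<longleftrightarrow> fst l < n \<and> fst m < n \<and> fst l \<noteq> fst m"
  by (auto simp: avoids_def)

lemma avoids_inv [simp]: "avoids l u \<Longrightarrow> avoids l (winvF u)"
  by (simp add: avoids_def F_inv winv_mem)

lemma avoids_mult [simp]: "avoids l u \<Longrightarrow> avoids l v \<Longrightarrow> avoids l (u \<cdot> v)"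
  using set_foldr_push[of u v] by (auto simp: avoids_def F_mult[of u v, symmetric])

text \<open>As \<open>l\<close> may be an inverse letter, this covers both sides:
  \<open>T (inv_letter x) v\<close> is the left multiplication of \<open>x\<close> by the inverse of
  \<open>v\<close>.\<close>

definition T :: "letter \<Rightarrow> letter list \<Rightarrow> letter list \<Rightarrow> letter list" where
  "T l u = endo (\<lambda>x. if x = l then [l] \<cdot> u else if x = inv_letter l then winvF u \<cdot> [inv_letter l] else [x])"

lemma T_compat:
  "avoids l u \<Longrightarrow>
    compat (\<lambda>x. if x = l then [l] \<cdot> u else if x = inv_letter l then winvF u \<cdot> [inv_letter l] else [x])"
  unfolding compat_def
proof (intro allI impI conjI)
  fix x :: letter assume *: "avoids l u" "fst x < n"
  note [simp] = avoidsD[OF *(1)]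
  show "(if x = l then [l] \<cdot> u else if x = inv_letter l then winvF u \<cdot> [inv_letter l] else [x]) \<in> carrier F"
    using * by simp
  consider "x = l" | "x = inv_letter l" | "x \<noteq> l" "x \<noteq> inv_letter l" by blast
  then show "(if inv_letter x = l then [l] \<cdot> u else if inv_letter x = inv_letter l then winvF u \<cdot> [inv_letter l] else [inv_letter x])
    = winvF (if x = l then [l] \<cdot> u else if x = inv_letter l then winvF u \<cdot> [inv_letter l] else [x])"
    by cases (use * in \<open>auto simp: F.inv_mult_group\<close>)
qed

lemma T_hom: "avoids l u \<Longrightarrow> T l u \<in> hom F F"
  unfolding T_def by (intro endo_hom T_compat)

lemma T_letter:
  assumes "avoids l u"
  shows "T l u [l] = [l] \<cdot> u" "T l u [inv_letter l] = winvF u \<cdot> [inv_letter l]"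
    "\<And>x. fst x < n \<Longrightarrow> fst x \<noteq> fst l \<Longrightarrow> T l u [x] = [x]"
  using assms avoidsD[OF assms] unfolding T_def by (subst endo_letter[OF T_compat]; auto)+

lemma T_fix:
  assumes "avoids l u" "avoids l w"
  shows "T l u w = w"
proof -
  have "id \<in> hom F F" by (simp add: hom_def)
  from hom_agree[OF T_hom[OF assms(1)] this, of w] show ?thesis
    using T_letter(3)[OF assms(1)] avoidsD(2)[OF assms(2)] avoids_set[OF assms(2)] by simp
qed

text \<open>Since \<open>T l u\<close> fixes the word \<open>u\<close>, which avoids
  \<open>l\<close>, the inverse is the transvection of \<open>l\<close> by the inverse of
  \<open>u\<close>.\<close>

lemma T_mem: 
  assumes "avoids l u"
  shows "T l u \<in> carrier A"
proof -
  have *: "T l (winvF v) ([l] \<cdot> v) = [l]" if "avoids l v" for v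
    using that avoidsD[OF that] T_fix[of l "winvF v" v]
    by (simp add: hom_mult[OF T_hom] T_letter F.m_assoc)
  have inv: "T l (winvF v) (if x = l then [l] \<cdot> v else if x = inv_letter l then winvF v \<cdot> [inv_letter l] else [x]) = [x]"
    if "x = l \<or> fst x \<noteq> fst l" "avoids l v" "fst x < n" for v x
    using that avoidsD[OF that(2)] *[of v] T_letter(3)[of l "winvF v" x] by auto
  have "endo (\<lambda>x. if x = l then [l] \<cdot> u else if x = inv_letter l then winvF u \<cdot> [inv_letter l] else [x]) \<in> carrier A"
  proof (rule endo_A[OF T_compat[OF assms] T_compat[OF avoids_inv[OF assms]]])
    fix i assume i: "i < n"
    \<comment> \<open>The sign is chosen so that for the generator of \<open>l\<close> the letter is
      \<open>l\<close> itself and not its inverse.\<close>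
    define b where "b = (if i = fst l then snd l else True)"
    have b: "(i, b) = l \<or> fst (i, b) \<noteq> fst l" by (auto simp: b_def prod_eq_iff)
    show "\<exists>b. endo (\<lambda>x. if x = l then [l] \<cdot> u else if x = inv_letter l then winvF u \<cdot> [inv_letter l] else [x])
       (if (i, b) = l then [l] \<cdot> winvF u else if (i, b) = inv_letter l then winvF (winvF u) \<cdot> [inv_letter l] else [(i, b)]) = [(i, b)]"
      using inv[OF b, of "winvF u"] assms avoidsD[OF assms] i by (intro exI[of _ b]) (simp add: T_def)
    show "\<exists>b. endo (\<lambda>x. if x = l then [l] \<cdot> winvF u else if x = inv_letter l then winvF (winvF u) \<cdot> [inv_letter l] else [x])
       (if (i, b) = l then [l] \<cdot> u else if (i, b) = inv_letter l then winvF u \<cdot> [inv_letter l] else [(i, b)]) = [(i, b)]"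
      using inv[OF b, of u] assms avoidsD[OF assms] i by (intro exI[of _ b]) (simp add: T_def)
  qed
  then show ?thesis by (simp add: T_def)
qed

lemma A_eqI_letter:
  assumes "\<phi> \<in> carrier A" "\<psi> \<in> carrier A" "\<phi> [l] = \<psi> [l]"
    "\<And>x. fst x < n \<Longrightarrow> fst x \<noteq> fst l \<Longrightarrow> \<phi> [x] = \<psi> [x]"
  shows "\<phi> = \<psi>"
proof (rule A_eqI[OF assms(1,2)])
  fix i assume "i < n"
  then show "\<exists>b. \<phi> [(i, b)] = \<psi> [(i, b)]"
    using assms(3) assms(4)[of "(i, snd l)"] by (cases "i = fst l") (auto intro: exI[of _ "snd l"])
qed

lemma A_hom_mult [simp]: "\<phi> \<in> carrier A \<Longrightarrow> u \<in> carrier F \<Longrightarrow> v \<in> carrier F \<Longrightarrow> \<phi> (u \<cdot> v) = \<phi> u \<cdot> \<phi> v"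
  by (simp add: hom_mult)

lemma A_hom_inv: "\<phi> \<in> carrier A \<Longrightarrow> u \<in> carrier F \<Longrightarrow> \<phi> (winvF u) = winvF (\<phi> u)"
  by (simp add: hom_inv)

lemma A_inv_letter: "\<phi> \<in> carrier A \<Longrightarrow> fst l < n \<Longrightarrow> \<phi> [inv_letter l] = winvF (\<phi> [l])"
  by (simp add: hom_inv_letter)

lemma T_mult: "avoids l u \<Longrightarrow> avoids l v \<Longrightarrow> T l u \<diamondop> T l v = T l (u \<cdot> v)"
  by (frule avoidsD(1), frule avoidsD(2), frule avoidsD(2)[of l v], rule A_eqI_letter[of _ _ l])
    (auto simp: T_mem T_letter T_fix F.m_assoc)

lemma T_Nil: "fst l < n \<Longrightarrow> T l [] = \<one>\<^bsub>A\<^esub>"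
  by (rule A_eqI_letter[of _ _ l]) (auto simp: T_mem T_letter)

lemma T_inv: "avoids l u \<Longrightarrow> inv\<^bsub>A\<^esub> (T l u) = T l (winvF u)"
  by (frule avoidsD(1), frule avoidsD(2), rule A.inv_equality) (simp_all add: T_mult T_mem T_Nil)

text \<open>One factor multiplies \<open>l\<close> on the right, the other on the left, and neither
  changes the word that the other one uses.\<close>

lemma T_comm:
  assumes "avoids l u" "avoids l v"
  shows "T l u \<diamondop> T (inv_letter l) v = T (inv_letter l) v \<diamondop> T l u"
proof (rule A_eqI_letter[of _ _ l])
  note [simp] = avoidsD[OF assms(1)] avoidsD[OF assms(2)]
  have *: "T (inv_letter l) v [l] = winvF v \<cdot> [l]"
    using T_letter(2)[of "inv_letter l" v] assms by simp
  then show "(T l u \<diamondop> T (inv_letter l) v) [l] = (T (inv_letter l) v \<diamondop> T l u) [l]"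
    using assms by (simp add: T_mem T_letter T_fix F.m_assoc)
qed (use assms avoidsD[OF assms(1)] in \<open>auto simp: T_mem T_letter T_fix\<close>)

text \<open>Conjugation by \<phi> turns the transvection of \<open>l\<close> by \<open>u\<close>
  into that of \<open>m\<close> by \<open>\<phi> u\<close>. Only \<open>l\<close> has to go to a
  letter; the other generators may go to any words that avoid \<open>m\<close>, so \<phi> can itself
  be a transvection.\<close>

lemma A_conj:
  assumes "\<phi> \<in> carrier A" "avoids l u" "\<phi> [l] = [m]"
    and "\<And>x. fst x < n \<Longrightarrow> fst x \<noteq> fst l \<Longrightarrow> avoids m (\<phi> [x])"
  shows "avoids m (\<phi> u)" "\<phi> \<diamondop> T l u = T m (\<phi> u) \<diamondop> \<phi>"
proof -
  note [simp] = avoidsD[OF assms(2)]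
  have m: "fst m < n" using A_mem[of \<phi> "[l]"] assms(1-3) by simp
  have "fst m \<notin> fst ` set (\<phi> u)"
  proof (rule hom_avoid[OF A_hom[OF assms(1)]])
    fix x assume "x \<in> set u"
    then have "fst x < n" "fst x \<noteq> fst l" using avoids_set[OF assms(2)] by blast+
    then show "fst m \<notin> fst ` set (\<phi> [x])" using assms(4) by (auto simp: avoids_def)
  qed (use assms in simp)
  then show *: "avoids m (\<phi> u)" using assms m by (simp add: avoids_def)
  show "\<phi> \<diamondop> T l u = T m (\<phi> u) \<diamondop> \<phi>"
    by (rule A_eqI_letter[of _ _ l]) (use assms * in \<open>auto simp: T_mem T_letter T_fix\<close>)
qed

text \<open>This is the commutator relation: conjugating \<open>T l [m]\<close> by
  \<open>T m [p]\<close> gives the transvection of \<open>l\<close> by \<open>m p\<close>, and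
  \<open>T l [inv_letter m]\<close> then removes \<open>m\<close>.\<close>

lemma T_trans:
  assumes H: "subgroup H A" and lm: "T l [m] \<in> H" and mp: "T m [p] \<in> H"
    and d: "fst l \<noteq> fst m" "fst m \<noteq> fst p" "fst l \<noteq> fst p" "fst l < n" "fst m < n" "fst p < n"
  shows "T l [p] \<in> H"
proof -
  have conj: "T m [p] \<diamondop> T l [m] = T l ([m] \<cdot> [p]) \<diamondop> T m [p]"
  proof -
    have "avoids l (T m [p] [x])" if "fst x < n" "fst x \<noteq> fst l" for x
    proof -
      consider "x = m" | "x = inv_letter m" | "fst x \<noteq> fst m" using fst_eq_cases by blast
      then show ?thesis by cases (use d that in \<open>auto simp: T_letter\<close>)
    qed
    then show ?thesis
      using A_conj(2)[of "T m [p]" l "[m]" l] d by (simp add: T_mem T_letter)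
  qed
  have "T l [inv_letter m] = inv\<^bsub>A\<^esub> (T l [m])"
    using T_inv[of l "[m]"] d by simp
  then have lm': "T l [inv_letter m] \<in> H" using lm H by (simp add: subgroup.m_inv_closed)
  have "T l [p] = T l ([inv_letter m] \<cdot> ([m] \<cdot> [p]))"
    using F_inv_cancel'(2)[of "[m]" "[p]"] d by simp
  also have "\<dots> = T l [inv_letter m] \<diamondop> T l ([m] \<cdot> [p])"
    using d by (subst T_mult) simp_all
  also have "T l ([m] \<cdot> [p]) = (T m [p] \<diamondop> T l [m]) \<diamondop> inv\<^bsub>A\<^esub> (T m [p])"
    unfolding conj using d by (simp add: A.m_assoc T_mem)
  finally show ?thesis
    using lm lm' mp H by (simp add: subgroup.m_inv_closed subgroup.m_closed)
qed

section \<open>Signed permutations of the generators\<close>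

definition lettery :: "(letter list \<Rightarrow> letter list) \<Rightarrow> bool" where
  "lettery \<phi> \<longleftrightarrow> (\<forall>l. fst l < n \<longrightarrow> (\<exists>m. \<phi> [l] = [m]))"

lemma lettery_avoids:
  assumes "\<phi> \<in> carrier A" "lettery \<phi>" "\<phi> [l] = [m]" "fst l < n" "fst x < n" "fst x \<noteq> fst l"
  shows "avoids m (\<phi> [x])"
proof -
  obtain y where y: "\<phi> [x] = [y]" using assms by (auto simp: lettery_def simp del: split_paired_All)
  have mn: "fst m < n" "fst y < n"
    using A_mem[of \<phi> "[l]"] A_mem[of \<phi> "[x]"] assms y by simp_all
  have "y \<noteq> m" using A_inj[of \<phi> "[x]" "[l]"] assms y by auto
  moreover have "\<phi> [inv_letter l] = [inv_letter m]"
    using A_inv_letter[of \<phi> l] assms mn by simp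
  then have "y \<noteq> inv_letter m"
    using A_inj[of \<phi> "[x]" "[inv_letter l]"] assms y by auto
  ultimately show ?thesis
    using y mn fst_eq_cases[of m y] by auto
qed

lemma lettery_conj:
  assumes "\<phi> \<in> carrier A" "lettery \<phi>" "\<phi> [l] = [m]" "avoids l u"
  shows "avoids m (\<phi> u)" "\<phi> \<diamondop> T l u \<diamondop> inv\<^bsub>A\<^esub> \<phi> = T m (\<phi> u)"
proof -
  note [simp] = avoidsD[OF assms(4)]
  have *: "avoids m (\<phi> [x])" if "fst x < n" "fst x \<noteq> fst l" for x
    using lettery_avoids[of \<phi> l m x] assms that by simp
  note c = A_conj[OF assms(1,4,3) *]
  show "avoids m (\<phi> u)" using c(1) .
  show "\<phi> \<diamondop> T l u \<diamondop> inv\<^bsub>A\<^esub> \<phi> = T m (\<phi> u)"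
    using c assms by (simp add: A.m_assoc T_mem)
qed

text \<open>The second component compares two truth values: the sign of the letter is kept where
  \<open>e\<close> is true and flipped where it is false.\<close>

definition sperm :: "(nat \<Rightarrow> nat) \<Rightarrow> (nat \<Rightarrow> bool) \<Rightarrow> letter list \<Rightarrow> letter list" where
  "sperm f e = endo (\<lambda>l. [(f (fst l), snd l = e (fst l))])"

lemma sperm_compat:
  assumes "f ` {..<n} \<subseteq> {..<n}"
  shows "compat (\<lambda>l. [(f (fst l), snd l = e (fst l))])"
  unfolding compat_def using assms by (auto simp: inv_letter_def)

lemma sperm_letter:
  assumes "f ` {..<n} \<subseteq> {..<n}" "i < n"
  shows "sperm f e [(i, b)] = [(f i, b = e i)]"
  unfolding sperm_def using assms by (simp add: endo_letter[OF sperm_compat])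

lemma sperm_mem:
  assumes "bij_betw f {..<n} {..<n}"
  shows "sperm f e \<in> carrier A"
proof -
  define g where "g = inv_into {..<n} f"
  have fn: "f ` {..<n} \<subseteq> {..<n}" using assms by (auto simp: bij_betw_def)
  have gn: "g ` {..<n} \<subseteq> {..<n}" using bij_betw_inv_into[OF assms] by (auto simp: bij_betw_def g_def)
  have inv: "g (f i) = i" "f (g i) = i" if "i < n" for i
    using assms that bij_betw_inv_into_left[OF assms, of i] bij_betw_inv_into_right[OF assms, of i]
    by (auto simp: g_def)
  note cf = sperm_compat[OF fn, of e] and cg = sperm_compat[OF gn, of "\<lambda>i. e (g i)"]
  show ?thesis
    unfolding sperm_def
  proof (rule endo_A[OF cf cg])
    fix i assume i: "i < n"
    then have "f i < n" "g i < n" using fn gn by auto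
    then show "\<exists>b. endo (\<lambda>l. [(f (fst l), snd l = e (fst l))]) [(g (fst (i, b)), snd (i, b) = e (g (fst (i, b))))] = [(i, b)]"
      "\<exists>b. endo (\<lambda>l. [(g (fst l), snd l = e (g (fst l)))]) [(f (fst (i, b)), snd (i, b) = e (fst (i, b)))] = [(i, b)]"
      using i by (auto simp: endo_letter[OF cf] endo_letter[OF cg] inv)
  qed
qed

lemma sperm_lettery: "f ` {..<n} \<subseteq> {..<n} \<Longrightarrow> lettery (sperm f e)"
  by (auto simp: lettery_def sperm_letter)

end

section \<open>Nielsen reduction\<close>

lemma lcp_decomp:
  obtains b c where "xs = longest_common_prefix xs ys @ b" "ys = longest_common_prefix xs ys @ c"
    "b \<noteq> [] \<Longrightarrow> c \<noteq> [] \<Longrightarrow> hd b \<noteq> hd c"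
proof -
  have "\<exists>b c. xs = longest_common_prefix xs ys @ b \<and> ys = longest_common_prefix xs ys @ c \<and>
    (b \<noteq> [] \<longrightarrow> c \<noteq> [] \<longrightarrow> hd b \<noteq> hd c)"
    by (induction xs ys rule: longest_common_prefix.induct) auto
  then show ?thesis using that by blast
qed

lemma lcp_commute: "longest_common_prefix xs ys = longest_common_prefix ys xs"
proof (induction xs ys rule: longest_common_prefix.induct)
  case ("2_1" ys)
  then show ?case by (cases ys) simp_all
next
  case ("2_2" xs)
  then show ?case by (cases xs) simp_all
qed simp

text \<open>The part of \<open>y\<close> that cancels in the product \<open>x y\<close>.\<close>
definition overlap :: "letter list \<Rightarrow> letter list \<Rightarrow> letter list" where
  "overlap x y = longest_common_prefix (winv x) y"

lemma overlap_winv: "overlap (winv y) (winv x) = overlap x y"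
  by (simp add: overlap_def lcp_commute)

text \<open>The condition on the heads excludes further cancellation where \<open>winv b\<close>
  meets \<open>c\<close>. The tail \<open>c\<close> is left free because the growth argument below
  replaces it.\<close>

lemma foldr_push_cancel:
  assumes "reduced x" "reduced (p @ c)" "winv x = p @ b" "b \<noteq> [] \<Longrightarrow> c \<noteq> [] \<Longrightarrow> hd b \<noteq> hd c"
  shows "foldr push x (p @ c) = winv b @ c" "reduced (winv b @ c)"
proof -
  have x: "x = winv b @ winv p" using arg_cong[OF assms(3), of winv] by simp
  have r: "reduced p" "reduced c" "reduced b"
    using assms(1,2) by (auto simp: x reduced_append)
  have "foldr push (winv p) (p @ c) = foldr push (winv p) (foldr push p c)"
    using assms(2) by (simp add: foldr_push_append)
  also have "\<dots> = foldr push (foldr push (winv p) p) c"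
    using r by (simp add: foldr_push_assoc)
  finally have 1: "foldr push (winv p) (p @ c) = c" using r by (simp add: foldr_push_winv)
  have "last (winv b) = inv_letter (hd b)" if "b \<noteq> []"
    using that by (cases b) (auto simp: winv_Cons)
  then show 2: "reduced (winv b @ c)"
    using r assms(4) by (auto simp: reduced_append)
  show "foldr push x (p @ c) = winv b @ c"
    using 1 2 by (simp add: x foldr_push_append)
qed

lemma overlap_cases:
  assumes "reduced x" "reduced y"
  obtains b c where "winv x = overlap x y @ b" "y = overlap x y @ c" "b \<noteq> [] \<Longrightarrow> c \<noteq> [] \<Longrightarrow> hd b \<noteq> hd c"
    "foldr push x y = winv b @ c"
proof -
  obtain b c where bc: "winv x = overlap x y @ b" "y = overlap x y @ c" "b \<noteq> [] \<Longrightarrow> c \<noteq> [] \<Longrightarrow> hd b \<noteq> hd c"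
    unfolding overlap_def using lcp_decomp[of "winv x" y] by blast
  moreover have "foldr push x (overlap x y @ c) = winv b @ c"
    using foldr_push_cancel(1)[OF assms(1) _ bc(1)] bc assms(2) by metis
  ultimately show ?thesis using that by metis
qed

lemma length_mult_overlap:
  assumes "reduced x" "reduced y"
  shows "length (foldr push x y) + 2 * length (overlap x y) = length x + length y"
proof -
  obtain b c where bc: "winv x = overlap x y @ b" "y = overlap x y @ c" "foldr push x y = winv b @ c"
    using overlap_cases[OF assms] by metis
  show ?thesis
    using arg_cong[OF bc(1), of length] arg_cong[OF bc(2), of length] arg_cong[OF bc(3), of length] by simp
qed

lemma reduced_nth: "reduced w \<Longrightarrow> Suc i < length w \<Longrightarrow> w ! Suc i \<noteq> inv_letter (w ! i)"
proof (induction w arbitrary: i)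
  case (Cons a w)
  then show ?case by (cases i) (auto simp: reduced_Cons hd_conv_nth)
qed simp

lemma winv_nth: "i < length x \<Longrightarrow> winv x ! i = inv_letter (x ! (length x - 1 - i))"
  by (simp add: winv_def rev_nth)

text \<open>If the first halves of \<open>x\<close> and of its inverse agreed, each letter in the
  first half would be inverse to its mirror image. In the middle of \<open>x\<close> this gives a
  letter inverse to itself or two adjacent inverse letters.\<close>

lemma take_half_neq:
  assumes "reduced x" "x \<noteq> []" "length x \<le> 2 * h" "h \<le> length x"
  shows "take h x \<noteq> take h (winv x)"
proof
  assume *: "take h x = take h (winv x)"
  have nth: "x ! i = inv_letter (x ! (length x - 1 - i))" if "i < h" for i
    using arg_cong[OF *, of "\<lambda>w. w ! i"] that assms(4) winv_nth[of i x] by simp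
  \<comment> \<open>The middle position: for odd length it is its own mirror image, for even length
    its mirror image is the next position.\<close>
  define j where "j = (length x - 1) div 2"
  have len: "length x > 0" using assms(2) by simp
  then have j: "j < h" using assms(3) unfolding j_def by linarith
  show False
  proof (cases "even (length x)")
    case True
    then obtain d where "length x = 2 * Suc d" using len
      by (metis evenE gr0_implies_Suc mult_0_right neq0_conv)
    then have "length x - 1 - j = Suc j" "Suc j < length x" by (auto simp: j_def)
    then show False using nth[OF j] reduced_nth[OF assms(1), of j] by simp
  next
    case False
    then have "length x - 1 - j = j" by (auto simp: j_def elim!: oddE)
    then show False using nth[OF j] by (metis inv_letter_simps(4))
  qed
qed

text \<open>What cancels in \<open>x x\<close> is a common prefix of \<open>x\<close> and its
  inverse, so it is shorter than half of \<open>x\<close>.\<close>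

lemma overlap_self:
  assumes "reduced x" "x \<noteq> []"
  shows "2 * length (overlap x x) < length x"
proof (rule ccontr)
  assume *: "\<not> ?thesis"
  obtain b c where bc: "winv x = overlap x x @ b" "x = overlap x x @ c"
    using overlap_cases[OF assms(1) assms(1)] by metis
  have "take (length (overlap x x)) x = overlap x x" "take (length (overlap x x)) (winv x) = overlap x x"
    using arg_cong[OF bc(1), of "take (length (overlap x x))"]
      arg_cong[OF bc(2), of "take (length (overlap x x))"] by simp_all
  moreover have "length (overlap x x) \<le> length x"
    using arg_cong[OF bc(2), of length] by simp
  ultimately show False using take_half_neq[OF assms, of "length (overlap x x)"] * by simp
qed

context free_group_rank
begin

section \<open>Elementary transvections and two weights on automorphisms\<close>

definition elementary :: "(letter list \<Rightarrow> letter list) set" where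
  "elementary = {T l [m] | l m. fst l < n \<and> fst m < n \<and> fst l \<noteq> fst m}"

abbreviation NG where "NG \<equiv> generate A elementary"

lemma elementary_A: "elementary \<subseteq> carrier A"
  unfolding elementary_def using T_mem avoids_letter by blast

lemma NG_subgroup: "subgroup NG A"
  by (rule A.generate_is_subgroup[OF elementary_A])

lemma T_NG: "fst l < n \<Longrightarrow> fst m < n \<Longrightarrow> fst l \<noteq> fst m \<Longrightarrow> T l [m] \<in> NG"
  unfolding elementary_def by (rule generate.incl) blast

definition weight :: "(letter list \<Rightarrow> nat) \<Rightarrow> (letter list \<Rightarrow> letter list) \<Rightarrow> nat" where
  "weight \<mu> \<phi> = (\<Sum>i<n. \<mu> (\<phi> [(i, True)]))"

text \<open>Only the image of the generator of \<open>l\<close> changes. Invariance of \<mu> under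
  inversion makes the sign of \<open>l\<close> irrelevant, although \<open>weight\<close> sums over
  positive letters.\<close>

lemma weight_T:
  assumes \<mu>: "\<And>w. \<mu> (winv w) = \<mu> w" and \<phi>: "\<phi> \<in> carrier A"
    and lm: "fst l < n" "fst m < n" "fst l \<noteq> fst m"
  shows "weight \<mu> (\<phi> \<diamondop> T l [m]) + \<mu> (\<phi> [l]) = weight \<mu> \<phi> + \<mu> (\<phi> [l] \<cdot> \<phi> [m])"
proof -
  have T: "T l [m] \<in> carrier A" using lm by (simp add: T_mem)
  let ?i = "fst l"
  have split: "weight \<mu> \<psi> = \<mu> (\<psi> [(?i, True)]) + (\<Sum>i\<in>{..<n} - {?i}. \<mu> (\<psi> [(i, True)]))" for \<psi>
    unfolding weight_def using lm(1) by (subst sum.remove[of _ ?i]) auto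
  have rest: "(\<Sum>i\<in>{..<n} - {?i}. \<mu> ((\<phi> \<diamondop> T l [m]) [(i, True)])) = (\<Sum>i\<in>{..<n} - {?i}. \<mu> (\<phi> [(i, True)]))"
    using lm \<phi> T by (intro sum.cong) (auto simp: T_letter)
  have \<mu>': "\<mu> (\<psi> [(?i, True)]) = \<mu> (\<psi> [l])" if "\<psi> \<in> carrier A" for \<psi>
  proof (cases "l = (?i, True)")
    case False
    then have "(?i, True) = inv_letter l" using fst_eq_cases[of "(?i, True)" l] by auto
    then show ?thesis using A_inv_letter[OF that, of l] lm that by (simp add: F_inv \<mu>)
  qed simp
  show ?thesis
    using split[of \<phi>] split[of "\<phi> \<diamondop> T l [m]"] rest \<mu>'[OF \<phi>] \<mu>'[of "\<phi> \<diamondop> T l [m]"] \<phi> T lm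
    by (simp add: T_letter)
qed

definition code :: "letter \<Rightarrow> nat" where "code l = 2 * fst l + of_bool (snd l)"

lemma code_less: "fst l < n \<Longrightarrow> code l < 2 * n"
  by (auto simp: code_def)

lemma code_inj: "code l = code m \<longleftrightarrow> l = m"
  by (cases "snd l"; cases "snd m") (auto simp: code_def prod_eq_iff, presburger+)

fun val :: "letter list \<Rightarrow> nat" where
  "val [] = 0"
| "val (x # xs) = code x * (2 * n) ^ length xs + val xs"

lemma val_append: "val (u @ v) = val u * (2 * n) ^ length v + val v"
  by (induction u) (auto simp: power_add algebra_simps)

lemma val_less: "\<forall>l\<in>set w. fst l < n \<Longrightarrow> val w < (2 * n) ^ length w"
proof (induction w)
  case (Cons x w)
  then have "val w < (2 * n) ^ length w" "Suc (code x) \<le> 2 * n" using code_less[of x] by auto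
  then have "val (x # w) < Suc (code x) * (2 * n) ^ length w" by simp
  also have "\<dots> \<le> (2 * n) * (2 * n) ^ length w"
    using \<open>Suc (code x) \<le> 2 * n\<close> by (rule mult_le_mono1)
  finally show ?case by simp
qed simp

lemma val_inj:
  assumes "length u = length v" "\<forall>l\<in>set u. fst l < n" "\<forall>l\<in>set v. fst l < n" "val u = val v"
  shows "u = v"
  using assms
proof (induction u v rule: list_induct2)
  case (Cons x xs y ys)
  define B where "B = (2 * n) ^ length xs"
  have lt: "val xs < B" "val ys < B" unfolding B_def using Cons.hyps Cons.prems val_less[of xs] val_less[of ys] by auto
  have eq: "code x * B + val xs = code y * B + val ys" using Cons by (simp add: B_def)
  have "(code x * B + val xs) div B = code x" "(code y * B + val ys) div B = code y"
    using lt by auto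
  then have "code x = code y" using eq by metis
  then show ?case using eq Cons by (simp add: code_inj B_def)
qed simp

text \<open>The tie-breaking weight: both halves of a word, read as numbers in base \<open>2n\<close>,
  so that comparing words of equal length is comparing them lexicographically.\<close>
definition half_weight :: "letter list \<Rightarrow> nat" where
  "half_weight w = val (take ((length w + 1) div 2) w) + val (take ((length w + 1) div 2) (winv w))"

lemma half_weight_winv [simp]: "half_weight (winv w) = half_weight w"
  by (simp add: half_weight_def)

text \<open>Because \<open>c\<close> is at least as long as the prefix, the first half of the word
  contains the whole prefix, while the first half of the inverse lies inside \<open>winv c\<close>
  and does not see the prefix.\<close>

lemma half_weight_less:
  assumes "length p = length q" "length q \<le> length c" "val p < val q" "n > 0"
  shows "half_weight (p @ c) < half_weight (q @ c)"
proof -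
  define h where "h = (length q + length c + 1) div 2"
  have h: "length q \<le> h" "h \<le> length c" using assms(2) by (auto simp: h_def)
  have "half_weight (r @ c) = val r * (2 * n) ^ length (take (h - length q) c)
      + val (take (h - length q) c) + val (take h (winv c))"
    if "length r = length q" for r
  proof -
    have "(length (r @ c) + 1) div 2 = h" using that by (simp add: h_def)
    then show ?thesis using that h unfolding half_weight_def by (simp add: val_append)
  qed
  then show ?thesis using assms by simp
qed

section \<open>Nielsen reduced automorphisms\<close>

definition cancel_len :: "(letter list \<Rightarrow> letter list) \<Rightarrow> letter \<Rightarrow> letter \<Rightarrow> nat" where
  "cancel_len \<phi> l m = length (overlap (\<phi> [l]) (\<phi> [m]))"

lemma A_letter_reduced: "\<phi> \<in> carrier A \<Longrightarrow> fst l < n \<Longrightarrow> reduced (\<phi> [l])"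
  using A_mem[of \<phi> "[l]"] by (simp add: mem_F)

lemma A_letter_neq_Nil: "\<phi> \<in> carrier A \<Longrightarrow> fst l < n \<Longrightarrow> \<phi> [l] \<noteq> []"
  using A_inj[of \<phi> "[l]" "[]"] by (auto simp: hom_Nil)

lemma A_inv_letter_winv: "\<phi> \<in> carrier A \<Longrightarrow> fst l < n \<Longrightarrow> \<phi> [inv_letter l] = winv (\<phi> [l])"
  by (simp add: A_inv_letter F_inv)

lemma cancel_len_inv:
  "\<phi> \<in> carrier A \<Longrightarrow> fst l < n \<Longrightarrow> fst m < n \<Longrightarrow> cancel_len \<phi> (inv_letter m) (inv_letter l) = cancel_len \<phi> l m"
  by (simp add: cancel_len_def A_inv_letter_winv overlap_winv)

text \<open>In the image of a reduced word every factor keeps at least one letter, hence the image is at least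
  as long as the word.\<close>
lemma nielsen_growth:
  assumes \<phi>: "\<phi> \<in> carrier A"
    and N1: "\<And>l m. fst l < n \<Longrightarrow> fst m < n \<Longrightarrow> m \<noteq> inv_letter l \<Longrightarrow>
      2 * cancel_len \<phi> l m \<le> length (\<phi> [l]) \<and> 2 * cancel_len \<phi> l m \<le> length (\<phi> [m])"
    and N2: "\<And>l m q. fst l < n \<Longrightarrow> fst m < n \<Longrightarrow> fst q < n \<Longrightarrow> m \<noteq> inv_letter l \<Longrightarrow> q \<noteq> inv_letter m \<Longrightarrow>
      cancel_len \<phi> l m + cancel_len \<phi> m q < length (\<phi> [m])"
    and u: "l # u \<in> carrier F"
  shows "\<exists>r. \<phi> (l # u) = take (length (\<phi> [l]) - (if u = [] then 0 else cancel_len \<phi> l (hd u))) (\<phi> [l]) @ r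
    \<and> length u \<le> length r"
  using u
proof (induction u arbitrary: l)
  case Nil
  then show ?case by simp
next
  case (Cons m u)
  have ln: "fst l < n" "fst m < n" "m \<noteq> inv_letter l" "m # u \<in> carrier F"
    and un: "u \<noteq> [] \<Longrightarrow> fst (hd u) < n \<and> hd u \<noteq> inv_letter m"
    using Cons.prems by (auto simp: mem_F reduced_Cons simp del: split_paired_All)
  define x y where "x = \<phi> [l]" and "y = \<phi> [m]"
  \<comment> \<open>The number of letters of \<open>y\<close> that are not cancelled by the factor
    after it.\<close>
  define t where "t = length y - (if u = [] then 0 else cancel_len \<phi> m (hd u))"
  obtain r where r: "\<phi> (m # u) = take t y @ r" "length u \<le> length r"
    using Cons.IH[OF ln(4)] unfolding t_def y_def by blast
  have xy: "reduced x" "reduced y" "y \<noteq> []"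
    using \<phi> ln by (simp_all add: x_def y_def A_letter_reduced A_letter_neq_Nil)
  define p where "p = overlap x y"
  have cl: "cancel_len \<phi> l m = length p" by (simp add: p_def x_def y_def cancel_len_def)
  obtain b c where bc: "winv x = p @ b" "y = p @ c" "b \<noteq> [] \<Longrightarrow> c \<noteq> [] \<Longrightarrow> hd b \<noteq> hd c"
    using overlap_cases[OF xy(1,2)] unfolding p_def by metis
  \<comment> \<open>What \<open>x\<close> cancels at the front of \<open>y\<close> ends strictly
    before what the next factor cancels at its back: by \<open>N2\<close>, or by \<open>N1\<close>
    and \<open>y\<close> being nonempty if there is no next factor.\<close>
  have pt: "length p < t"
  proof (cases "u = []")
    case True
    then show ?thesis using N1[OF ln(1-3)] xy(3) cl
      by (simp add: t_def y_def) (metis length_greater_0_conv add_less_cancel_left le_less_trans linorder_not_less mult_2 trans_le_add1 not_add_less1 nat_less_le)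
  next
    case False
    then show ?thesis using N2[OF ln(1,2) _ ln(3), of "hd u"] un cl by (simp add: t_def flip: y_def)
  qed
  then have cne: "c \<noteq> []" using bc(2) t_def by auto
  \<comment> \<open>A letter of \<open>y\<close> survives in between, so \<open>c2\<close> begins
    like \<open>c\<close> and the cancellation with \<open>x\<close> stops exactly where it stops in
    the product \<open>x y\<close>.\<close>
  define c2 where "c2 = take (t - length p) c @ r"
  have c2: "take t y @ r = p @ c2" using pt by (simp add: c2_def bc(2))
  have hd2: "hd c2 = hd c" "c2 \<noteq> []" using pt cne by (auto simp: c2_def)
  have len2: "Suc (length u) \<le> length c2"
    using pt cne r(2) by (cases c) (auto simp: c2_def)
  have "\<phi> (m # u) \<in> carrier F" using \<phi> ln by simp
  then have red: "reduced (p @ c2)" using r c2 by (simp add: mem_F)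
  have "\<phi> (l # m # u) = x \<cdot> \<phi> (m # u)"
    using F_Cons[OF Cons.prems] \<phi> ln A_hom_mult[OF \<phi>, of "[l]" "m # u"] by (simp add: x_def)
  also have "\<dots> = winv b @ c2"
    using foldr_push_cancel(1)[OF xy(1) red bc(1)] bc(3) hd2 cne r(1) c2 by (simp add: F_mult)
  finally have 1: "\<phi> (l # m # u) = winv b @ c2" .
  have "x = winv b @ winv p" using arg_cong[OF bc(1), of winv] by simp
  then have "take (length x - length p) x = winv b" by simp
  then show ?case using 1 len2 cl by (intro exI[of _ c2]) (simp flip: x_def)
qed

lemma letters_finite: "finite {l::letter. fst l < n}"
proof -
  have "{l::letter. fst l < n} = {..<n} \<times> UNIV" by auto
  then show ?thesis by simp
qed

text \<open>Pigeonhole: choosing for each letter a letter mapped to it is injective on a finite set,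
  hence every letter is a chosen one.\<close>

lemma lettery_of_onto:
  assumes \<phi>: "\<phi> \<in> carrier A" and on: "\<And>l. fst l < n \<Longrightarrow> \<exists>m. fst m < n \<and> \<phi> [m] = [l]"
  shows "lettery \<phi>"
proof -
  obtain g where g: "\<And>l. fst l < n \<Longrightarrow> fst (g l) < n \<and> \<phi> [g l] = [l]" using on by metis
  have "g ` {l. fst l < n} = {l. fst l < n}"
  proof (rule endo_inj_surj[OF letters_finite])
    show "inj_on g {l. fst l < n}"
      by (rule inj_onI) (metis g list.inject mem_Collect_eq)
  qed (use g in auto)
  then show ?thesis unfolding lettery_def using g by (metis (mono_tags, lifting) imageE mem_Collect_eq)
qed

lemma lettery_onto:
  assumes \<phi>: "\<phi> \<in> carrier A" and le: "lettery \<phi>" and l: "fst l < n"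
  shows "\<exists>m. fst m < n \<and> \<phi> [m] = [l]"
proof -
  obtain g where g: "\<And>l. fst l < n \<Longrightarrow> \<phi> [l] = [g l]" using le unfolding lettery_def by metis
  have gn: "fst (g l) < n" if "fst l < n" for l
    using A_mem[OF \<phi>, of "[l]"] g[OF that] that by simp
  have "g ` {l. fst l < n} = {l. fst l < n}"
  proof (rule endo_inj_surj[OF letters_finite])
    show "inj_on g {l. fst l < n}"
    proof (rule inj_onI)
      fix x y assume "x \<in> {l. fst l < n}" "y \<in> {l. fst l < n}" "g x = g y"
      then show "x = y" using A_inj[OF \<phi>, of "[x]" "[y]"] g by simp
    qed
  qed (use gn in auto)
  then show ?thesis using g l by (metis (mono_tags, lifting) imageE mem_Collect_eq)
qed

text \<open>Minimal length gives \<open>N1\<close>: at most half of either factor cancels. Minimal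
  half weight among equal lengths gives \<open>N2\<close>: some letter of the middle factor
  survives. By \<open>nielsen_growth\<close> a word whose image is one letter is then itself one
  letter, so every letter is the image of a letter.\<close>

lemma nielsen_reduced_lettery:
  assumes \<phi>: "\<phi> \<in> carrier A"
    and min1: "\<And>l m. fst l < n \<Longrightarrow> fst m < n \<Longrightarrow> fst l \<noteq> fst m \<Longrightarrow> weight length \<phi> \<le> weight length (\<phi> \<diamondop> T l [m])"
    and min2: "\<And>l m. fst l < n \<Longrightarrow> fst m < n \<Longrightarrow> fst l \<noteq> fst m \<Longrightarrow>
      weight length (\<phi> \<diamondop> T l [m]) = weight length \<phi> \<Longrightarrow> weight half_weight \<phi> \<le> weight half_weight (\<phi> \<diamondop> T l [m])"
  shows "lettery \<phi>"
proof -
  have len: "length (\<phi> [l] \<cdot> \<phi> [m]) + 2 * cancel_len \<phi> l m = length (\<phi> [l]) + length (\<phi> [m])"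
    if "fst l < n" "fst m < n" for l m
    using length_mult_overlap[of "\<phi> [l]" "\<phi> [m]"] that \<phi> by (simp add: A_letter_reduced cancel_len_def F_mult)
  have self: "2 * cancel_len \<phi> l l < length (\<phi> [l])" if "fst l < n" for l
    using overlap_self[of "\<phi> [l]"] that \<phi> by (simp add: A_letter_reduced A_letter_neq_Nil cancel_len_def)
  have N1': "2 * cancel_len \<phi> l m \<le> length (\<phi> [m])" if lm: "fst l < n" "fst m < n" "m \<noteq> inv_letter l" for l m
  proof (cases "fst l = fst m")
    case True
    then have "m = l" using fst_eq_cases[of l m] lm by auto
    then show ?thesis using self[OF lm(1)] by simp
  next
    case False
    then show ?thesis
      using weight_T[of length \<phi> l m] min1[of l m] len[of l m] \<phi> lm by simp
  qed
  have N1: "2 * cancel_len \<phi> l m \<le> length (\<phi> [l]) \<and> 2 * cancel_len \<phi> l m \<le> length (\<phi> [m])"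
    if lm: "fst l < n" "fst m < n" "m \<noteq> inv_letter l" for l m
    using N1'[OF lm] N1'[of "inv_letter m" "inv_letter l"] lm \<phi>
    by (auto simp: cancel_len_inv A_inv_letter_winv)
  \<comment> \<open>If exactly half of \<open>\<phi> [m]\<close> cancels against \<open>\<phi> [q]\<close>, multiplying \<open>\<phi> [q]\<close> by \<open>\<phi> [m]\<close> keeps all lengths,
    so the half weight decides. If \<open>N2\<close> failed, this would apply from both sides and make both
    halves of \<open>\<phi> [m]\<close> equal.\<close>
  have key: "val (take (cancel_len \<phi> m q) (winv (\<phi> [m]))) \<le> val (take (cancel_len \<phi> m q) (\<phi> [m]))"
    if mq: "fst m < n" "fst q < n" "fst m \<noteq> fst q" and half: "2 * cancel_len \<phi> m q = length (\<phi> [m])" for m q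
  proof (rule ccontr)
    assume *: "\<not> ?thesis"
    define Q where "Q = overlap (\<phi> [m]) (\<phi> [q])"
    obtain b c where bc: "winv (\<phi> [m]) = Q @ b" "\<phi> [q] = Q @ c" "foldr push (\<phi> [m]) (\<phi> [q]) = winv b @ c"
      using overlap_cases[of "\<phi> [m]" "\<phi> [q]"] \<phi> mq unfolding Q_def by (metis A_letter_reduced)
    have m: "\<phi> [m] = winv b @ winv Q" using arg_cong[OF bc(1), of winv] by simp
    have cl: "cancel_len \<phi> m q = length Q" by (simp add: cancel_len_def Q_def)
    have lens: "length b = length Q" "length Q \<le> length c"
    proof -
      have "q \<noteq> inv_letter m" using mq by auto
      then have "2 * length Q \<le> length (\<phi> [q])" using N1[of m q] mq cl by simp
      then show "length b = length Q" "length Q \<le> length c" using half m bc(2) cl by simp_all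
    qed
    have "val (winv b) < val Q" using * lens by (simp add: cl bc(1) m)
    then have less: "half_weight (winv b @ c) < half_weight (Q @ c)"
      using lens mq by (intro half_weight_less) auto
    \<comment> \<open>Multiplying \<open>\<phi> [q]\<close> by \<open>\<phi> [m]\<close> on the left
      is a transvection of the inverse letter of \<open>q\<close>, so the product is written with
      inverse letters; it replaces the prefix \<open>Q\<close> of \<open>\<phi> [q]\<close> by
      \<open>winv b\<close>.\<close>
    have prod: "\<phi> [inv_letter q] \<cdot> \<phi> [inv_letter m] = winv (winv b @ c)"
    proof -
      have "\<phi> [inv_letter q] \<cdot> \<phi> [inv_letter m] = winvF (\<phi> [m] \<cdot> \<phi> [q])"
        using \<phi> mq by (simp add: A_inv_letter F.inv_mult_group)
      also have "\<dots> = winv (\<phi> [m] \<cdot> \<phi> [q])"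
        using \<phi> mq by (intro F_inv) simp
      finally show ?thesis using bc(3) by (simp add: F_mult)
    qed
    note w = weight_T[of _ \<phi> "inv_letter q" "inv_letter m"]
    have "weight length (\<phi> \<diamondop> T (inv_letter q) [inv_letter m]) = weight length \<phi>"
      using w[of length] \<phi> mq prod lens bc(2) by (simp add: A_inv_letter_winv)
    from min2[OF _ _ _ this]
    have "weight half_weight \<phi> \<le> weight half_weight (\<phi> \<diamondop> T (inv_letter q) [inv_letter m])"
      using mq by simp
    moreover have "half_weight (\<phi> [inv_letter q]) = half_weight (Q @ c)"
      using A_inv_letter_winv[OF \<phi> mq(2)] bc(2) by (simp only: half_weight_winv)
    moreover have "half_weight (\<phi> [inv_letter q] \<cdot> \<phi> [inv_letter m]) = half_weight (winv b @ c)"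
      unfolding prod by (rule half_weight_winv)
    ultimately show False
      using w[of half_weight, OF half_weight_winv \<phi>] mq less by simp
  qed
  have N2: "cancel_len \<phi> l m + cancel_len \<phi> m q < length (\<phi> [m])"
    if lmq: "fst l < n" "fst m < n" "fst q < n" "m \<noteq> inv_letter l" "q \<noteq> inv_letter m" for l m q
  proof (rule ccontr)
    assume *: "\<not> ?thesis"
    define h where "h = cancel_len \<phi> m q"
    have eq: "2 * cancel_len \<phi> l m = length (\<phi> [m])" "2 * h = length (\<phi> [m])"
      using * N1[of l m] N1[of m q] lmq by (auto simp: h_def)
    then have h': "cancel_len \<phi> (inv_letter m) (inv_letter l) = h"
      using \<phi> lmq by (simp add: cancel_len_inv)
    \<comment> \<open>A word cannot cancel half of itself in its own square, by
      \<open>overlap_self\<close>.\<close>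
    have "l \<noteq> m" "q \<noteq> m" using self[of m] eq lmq(2) by (auto simp: h_def)
    then have d: "fst m \<noteq> fst q" "fst l \<noteq> fst m"
      using lmq fst_eq_cases[of q m] fst_eq_cases[of m l] by metis+
    have "val (take h (winv (\<phi> [m]))) \<le> val (take h (\<phi> [m]))"
      using key[of m q] eq d lmq by (simp add: h_def)
    moreover have "val (take h (\<phi> [m])) \<le> val (take h (winv (\<phi> [m])))"
      using key[of "inv_letter m" "inv_letter l"] h' eq d lmq \<phi> by (simp add: A_inv_letter_winv)
    ultimately have "val (take h (\<phi> [m])) = val (take h (winv (\<phi> [m])))" by simp
    moreover have "\<forall>l\<in>set (\<phi> [m]). fst l < n" "\<forall>l\<in>set (winv (\<phi> [m])). fst l < n"
      using A_mem[OF \<phi>, of "[m]"] lmq by (auto simp: mem_F set_winv)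
    ultimately have "take h (\<phi> [m]) = take h (winv (\<phi> [m]))"
      by (intro val_inj) (auto dest: in_set_takeD)
    then show False
      using take_half_neq[of "\<phi> [m]" h] eq \<phi> lmq by (simp add: A_letter_reduced A_letter_neq_Nil)
  qed
  show ?thesis
  proof (rule lettery_of_onto[OF \<phi>])
    fix l :: letter assume l: "fst l < n"
    then have "[l] \<in> \<phi> ` carrier F"
      using A_bij[OF \<phi>] by (simp add: bij_betw_def)
    then obtain w where w: "w \<in> carrier F" "\<phi> w = [l]"
      by (metis imageE)
    then obtain m u where mu: "w = m # u" using \<phi> by (cases w) (auto simp: hom_Nil)
    have m: "fst m < n" using w mu by (simp add: mem_F)
    obtain r where r: "\<phi> (m # u) = take (length (\<phi> [m]) - (if u = [] then 0 else cancel_len \<phi> m (hd u))) (\<phi> [m]) @ r"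
      "length u \<le> length r"
      using nielsen_growth[OF \<phi> N1 N2, of m u] w mu by blast
    \<comment> \<open>Otherwise the image contains a surviving letter of \<open>\<phi> [m]\<close>
      and at least \<open>length u\<close> further letters, too many for a single letter.\<close>
    have "u = []"
    proof (rule ccontr)
      assume u: "u \<noteq> []"
      then have "fst (hd u) < n" "hd u \<noteq> inv_letter m" using w mu by (auto simp: mem_F reduced_Cons simp del: split_paired_All)
      then have "cancel_len \<phi> m (hd u) < length (\<phi> [m])"
        using N1[of m "hd u"] m A_letter_neq_Nil[OF \<phi> m] by (cases "\<phi> [m]") auto
      then have "length (\<phi> (m # u)) > length u" using r u by simp
      then show False using w mu u by simp
    qed
    then show "\<exists>m. fst m < n \<and> \<phi> [m] = [l]" using w mu m by blast
  qed
qed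

text \<open>While the automorphism is no signed permutation, some elementary transvection lowers the
  pair of total length and total half weight lexicographically.\<close>

theorem nielsen_reduction:
  assumes "\<phi> \<in> carrier A"
  shows "\<exists>\<psi>\<in>NG. lettery (\<phi> \<diamondop> \<psi>)"
  using assms
proof (induction \<phi> rule: wf_induct_rule[OF wf_inv_image[OF wf_lex_prod[OF wf_less_than wf_less_than]],
      of "\<lambda>\<phi>. (weight length \<phi>, weight half_weight \<phi>)"])
  case (1 \<phi>)
  note \<phi> = 1(2)
  show ?case
  proof (cases "lettery \<phi>")
    case True
    then show ?thesis using \<phi> by (intro bexI[of _ "\<one>\<^bsub>A\<^esub>"]) (auto simp: generate.one)
  next
    case False
    then obtain l m where lm: "fst l < n" "fst m < n" "fst l \<noteq> fst m"
      and less: "weight length (\<phi> \<diamondop> T l [m]) < weight length \<phi> \<or>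
        weight length (\<phi> \<diamondop> T l [m]) = weight length \<phi> \<and> weight half_weight (\<phi> \<diamondop> T l [m]) < weight half_weight \<phi>"
      using nielsen_reduced_lettery[OF \<phi>] by (metis linorder_not_less)
    have T: "T l [m] \<in> carrier A" "T l [m] \<in> NG" using lm by (simp_all add: T_mem T_NG)
    obtain \<psi> where \<psi>: "\<psi> \<in> NG" "lettery (\<phi> \<diamondop> T l [m] \<diamondop> \<psi>)"
      using 1(1)[of "\<phi> \<diamondop> T l [m]"] less \<phi> T by auto
    have "\<psi> \<in> carrier A" using \<psi> A.generate_in_carrier[OF elementary_A] by blast
    then show ?thesis
      using \<psi> T \<phi> by (intro bexI[of _ "T l [m] \<diamondop> \<psi>"]) (auto simp: A.m_assoc generate.eng)
  qed
qed

end

section \<open>The action on the abelianisation\<close>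

lemma expsum_simps [simp]:
  "expsum i [] = 0" "expsum i (u @ v) = expsum i u + expsum i v"
  "expsum i (x # u) = (if fst x = i then (if snd x then 1 else - 1) else 0) + expsum i u"
  by (simp_all add: expsum_def)

lemma expsum_winv [simp]: "expsum i (winv w) = - expsum i w"
  by (induction w) (auto simp: winv_Cons inv_letter_def)

lemma expsum_push: "expsum i (push x w) = expsum i [x] + expsum i w"
  by (cases w) (auto simp: inv_letter_def)

lemma expsum_foldr_push: "expsum i (foldr push u v) = expsum i u + expsum i v"
  by (induction u) (auto simp: expsum_push)

lemma expsum_avoid: "i \<notin> fst ` set u \<Longrightarrow> expsum i u = 0"
  by (induction u) auto

section \<open>Row reduction over the integers\<close>

text \<open>The pivot obtained in a column is a unit because the matrix has a left inverse.\<close>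
lemma SL_rowop_induct:
  fixes A :: "int mat"
  assumes S1: "1\<^sub>m n \<in> S"
    and S: "\<And>A a k l. A \<in> carrier_mat n n \<Longrightarrow> k \<noteq> l \<Longrightarrow> k < n \<Longrightarrow> l < n \<Longrightarrow> addrow a k l A \<in> S \<Longrightarrow> A \<in> S"
    and A: "A \<in> carrier_mat n n" "det A = 1"
  shows "A \<in> S"
proof -
  \<comment> \<open>The invariant of the reduction: determinant one, and the first \<open>r\<close>
    columns are already those of the identity.\<close>
  define good where "good r A \<longleftrightarrow> A \<in> carrier_mat n n \<and> det A = 1 \<and>
    (\<forall>i<n. \<forall>j<r. A $$ (i, j) = (if i = j then 1 else 0))" for r and A :: "int mat"
  have idx: "addrow a k l A $$ (i, j) = (if i = k then a * A $$ (l, j) + A $$ (k, j) else A $$ (i, j))"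
    if "A \<in> carrier_mat n n" "i < n" "j < n" for A :: "int mat" and a k l i j
    using that by auto
  \<comment> \<open>Row \<open>l\<close> vanishes in the first \<open>r\<close> columns because
    \<open>r \<le> l\<close>, so adding it to another row leaves these columns alone.\<close>
  have good_addrow: "good r (addrow a k l A)"
    if "good r A" "k \<noteq> l" "k < n" "l < n" "r \<le> l" "r \<le> n" for r A a k l
    using that unfolding good_def by (auto simp: det_addrow idx)
  have main: "good r A \<Longrightarrow> r \<le> n \<Longrightarrow> A \<in> S" for r A
  proof (induction "n - r" arbitrary: r A)
    case 0
    then have "A = 1\<^sub>m n" by (intro eq_matI) (auto simp: good_def)
    then show ?case using S1 by simp
  next
    case (Suc d)
    then have rn: "r < n" by simp
    have IH: "good (Suc r) B \<Longrightarrow> B \<in> S" for B using Suc.hyps(1)[of "Suc r" B] Suc.hyps(2) rn by simp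
    \<comment> \<open>Once the pivot is 1, multiples of its row remove the other entries of the
      column, one at a time.\<close>
    have clear: "B \<in> S" if "good r B" "B $$ (r, r) = 1" for B
      using that
    proof (induction "card {i. i < n \<and> i \<noteq> r \<and> B $$ (i, r) \<noteq> 0}" arbitrary: B rule: less_induct)
      case less
      have B: "B \<in> carrier_mat n n" using less.prems by (simp add: good_def)
      show ?case
      proof (cases "\<exists>i<n. i \<noteq> r \<and> B $$ (i, r) \<noteq> 0")
        case False
        then have "good (Suc r) B" using less.prems by (auto simp: good_def less_Suc_eq)
        then show ?thesis by (rule IH)
      next
        case True
        then obtain i where i: "i < n" "i \<noteq> r" "B $$ (i, r) \<noteq> 0" by blast
        let ?C = "addrow (- B $$ (i, r)) i r B"
        have C: "?C $$ (j, r) = (if j = i then 0 else B $$ (j, r))" if "j < n" for j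
          using idx[OF B that rn] less.prems(2) by simp
        have "{j. j < n \<and> j \<noteq> r \<and> ?C $$ (j, r) \<noteq> 0} \<subset> {j. j < n \<and> j \<noteq> r \<and> B $$ (j, r) \<noteq> 0}"
        proof (rule psubsetI)
          show "{j. j < n \<and> j \<noteq> r \<and> ?C $$ (j, r) \<noteq> 0} \<subseteq> {j. j < n \<and> j \<noteq> r \<and> B $$ (j, r) \<noteq> 0}"
            by (rule Collect_mono) (metis C)
          have "i \<in> {j. j < n \<and> j \<noteq> r \<and> B $$ (j, r) \<noteq> 0}" "i \<notin> {j. j < n \<and> j \<noteq> r \<and> ?C $$ (j, r) \<noteq> 0}"
            using C[OF i(1)] i by simp_all
          then show "{j. j < n \<and> j \<noteq> r \<and> ?C $$ (j, r) \<noteq> 0} \<noteq> {j. j < n \<and> j \<noteq> r \<and> B $$ (j, r) \<noteq> 0}"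
            by blast
        qed
        then have "card {j. j < n \<and> j \<noteq> r \<and> ?C $$ (j, r) \<noteq> 0} < card {j. j < n \<and> j \<noteq> r \<and> B $$ (j, r) \<noteq> 0}"
          by (intro psubset_card_mono) auto
        moreover have "good r ?C" using good_addrow[of r B i r] less.prems i rn by simp
        moreover have "?C $$ (r, r) = 1" using C[OF rn] i less.prems by simp
        ultimately have "?C \<in> S" by (rule less.hyps)
        then show ?thesis using S[OF B i(2,1) rn] by blast
      qed
    qed
    \<comment> \<open>The Euclidean algorithm on the entries of column \<open>r\<close> from row
      \<open>r\<close> down, by induction on the sum of their absolute values.\<close>
    show ?case using Suc.prems(1)
    proof (induction "\<Sum>i\<in>{r..<n}. nat \<bar>A $$ (i, r)\<bar>" arbitrary: A rule: less_induct)
      case less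
      have A: "A \<in> carrier_mat n n" using less.prems by (simp add: good_def)
      show ?case
      proof (cases "\<exists>i j. r \<le> i \<and> i < n \<and> r \<le> j \<and> j < n \<and> i \<noteq> j \<and> A $$ (j, r) \<noteq> 0 \<and> \<bar>A $$ (j, r)\<bar> \<le> \<bar>A $$ (i, r)\<bar>")
        case True
        then obtain i j where ij: "r \<le> i" "i < n" "r \<le> j" "j < n" "i \<noteq> j" "A $$ (j, r) \<noteq> 0"
          "\<bar>A $$ (j, r)\<bar> \<le> \<bar>A $$ (i, r)\<bar>" by blast
        \<comment> \<open>The sign for which adding row \<open>j\<close> to row \<open>i\<close>
          lowers the absolute value of the larger entry.\<close>
        define e where "e = - sgn (A $$ (j, r)) * sgn (A $$ (i, r))"
        let ?C = "addrow e i j A"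
        have lt: "\<bar>e * A $$ (j, r) + A $$ (i, r)\<bar> < \<bar>A $$ (i, r)\<bar>"
          using ij(6,7) by (auto simp: e_def sgn_if abs_if split: if_splits)
        have "(\<Sum>k\<in>{r..<n}. nat \<bar>?C $$ (k, r)\<bar>) < (\<Sum>k\<in>{r..<n}. nat \<bar>A $$ (k, r)\<bar>)"
        proof (rule sum_strict_mono_ex1)
          show "\<forall>k\<in>{r..<n}. nat \<bar>?C $$ (k, r)\<bar> \<le> nat \<bar>A $$ (k, r)\<bar>"
            using idx[OF A _ rn] lt by auto
          show "\<exists>k\<in>{r..<n}. nat \<bar>?C $$ (k, r)\<bar> < nat \<bar>A $$ (k, r)\<bar>"
            using idx[OF A _ rn] lt ij by (intro bexI[of _ i]) auto
        qed simp
        moreover have "good r ?C" using good_addrow less.prems ij rn by simp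
        ultimately have "?C \<in> S" by (rule less.hyps)
        then show ?thesis using S[OF A] ij by blast
      next
        case False
        have uniq: "i = j" if "r \<le> i" "i < n" "A $$ (i, r) \<noteq> 0" "r \<le> j" "j < n" "A $$ (j, r) \<noteq> 0" for i j
          using False that by (metis linear)
        have "det A = 1" using less.prems by (simp add: good_def)
        then have adj: "adj_mat A * A = 1\<^sub>m n" "adj_mat A \<in> carrier_mat n n"
          using adj_mat[OF A] by auto
        \<comment> \<open>Row \<open>r\<close> of the inverse vanishes before position
          \<open>r\<close>, since the earlier columns of \<open>A\<close> are unit vectors. Its
          product with column \<open>r\<close> therefore involves only the single remaining entry,
          which must be a unit.\<close>
        define B where "B = adj_mat A"
        have BA: "(\<Sum>k\<in>{0..<n}. B $$ (r, k) * A $$ (k, j)) = (if r = j then 1 else 0)" if "j < n" for j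
        proof -
          have "(B * A) $$ (r, j) = (\<Sum>k\<in>{0..<n}. B $$ (r, k) * A $$ (k, j))"
            using adj(2) A that rn by (auto simp: B_def scalar_prod_def)
          then show ?thesis using adj(1) that rn by (simp add: B_def)
        qed
        have B0: "B $$ (r, j) = 0" if "j < r" for j
        proof -
          have "(\<Sum>k\<in>{0..<n}. B $$ (r, k) * A $$ (k, j)) = (\<Sum>k\<in>{0..<n}. if k = j then B $$ (r, k) else 0)"
            using less.prems that rn by (intro sum.cong) (auto simp: good_def)
          then show ?thesis using BA[of j] that rn by simp
        qed
        have "\<exists>i. r \<le> i \<and> i < n \<and> A $$ (i, r) \<noteq> 0"
        proof (rule ccontr)
          assume "\<not> ?thesis"
          then have "(\<Sum>k\<in>{0..<n}. B $$ (r, k) * A $$ (k, r)) = 0"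
            using B0 by (intro sum.neutral) (metis atLeastLessThan_iff linorder_not_less mult_eq_0_iff)
          then show False using BA[OF rn] by simp
        qed
        then obtain i where i: "r \<le> i" "i < n" "A $$ (i, r) \<noteq> 0" by blast
        have z: "A $$ (j, r) = 0" if "r \<le> j" "j < n" "j \<noteq> i" for j using uniq i that by blast
        have "(\<Sum>k\<in>{0..<n}. B $$ (r, k) * A $$ (k, r)) = (\<Sum>k\<in>{0..<n}. if k = i then B $$ (r, k) * A $$ (k, r) else 0)"
          using B0 z by (intro sum.cong) (auto, metis linorder_not_less)
        then have "B $$ (r, i) * A $$ (i, r) = 1" using BA[OF rn] i by simp
        then have unit: "A $$ (i, r) = 1 \<or> A $$ (i, r) = - 1" by (metis pos_zmult_eq_1_iff_lemma mult.commute zmult_eq_1_iff)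
        \<comment> \<open>A unit off the diagonal is used to create the pivot 1; a pivot -1 is
          repaired with the help of the next row; in the last column the value -1 contradicts the
          determinant.\<close>
        consider "i \<noteq> r" | "i = r" "A $$ (r, r) = 1" | "i = r" "A $$ (r, r) = - 1" "Suc r < n"
          | "i = r" "A $$ (r, r) = - 1" "Suc r = n"
          using unit rn by (metis Suc_lessI)
        then show ?thesis
        proof cases
          case 1
          let ?C = "addrow (A $$ (i, r)) r i A"
          have "?C $$ (r, r) = 1" using idx[OF A rn rn] z[of r] 1 rn unit by auto
          then have "?C \<in> S" using clear good_addrow less.prems 1 i rn by simp
          then show ?thesis using S[OF A] 1 i rn by metis
        next
          case 2
          then show ?thesis using clear less.prems by simp
        next
          case 3
          \<comment> \<open>The entries in rows \<open>r\<close> and \<open>Suc r\<close> go from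
            (-1, 0) to (-1, 1) and then to (1, 1).\<close>
          let ?C = "addrow (- 1) (Suc r) r A"
          let ?D = "addrow 2 r (Suc r) ?C"
          have C: "?C \<in> carrier_mat n n" using A by auto
          have "?C $$ (Suc r, r) = 1" "?C $$ (r, r) = - 1"
            using idx[OF A 3(3) rn] idx[OF A rn rn] z[of "Suc r"] 3 by simp_all
          then have "?D $$ (r, r) = 1" using idx[OF C rn rn] by simp
          moreover have "good r ?D" using good_addrow less.prems 3 by simp
          ultimately have "?D \<in> S" using clear by blast
          then have "?C \<in> S" using S[OF C, of r "Suc r" 2] 3 rn by simp
          then show ?thesis using S[OF A, of "Suc r" r] 3 rn by simp
        next
          case 4
          have "upper_triangular A" 
          proof
            fix i j assume "j < i" "i < dim_row A"
            then show "A $$ (i, j) = 0" using less.prems 4 A by (auto simp: good_def)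
          qed
          then have "det A = prod_list (diag_mat A)" using det_upper_triangular A by blast
          also have "\<dots> = (\<Prod>i = 0..<n. A $$ (i, i))" using A by (simp add: prod_list_diag_prod)
          also have "\<dots> = (\<Prod>i = 0..<n. if i = r then - 1 else 1)"
            using less.prems 4 by (intro prod.cong) (auto simp: good_def)
          also have "\<dots> = - 1" using rn by simp
          finally show ?thesis using less.prems by (simp add: good_def)
        qed
      qed
    qed
  qed
  show ?thesis using main[of 0 A] A by (simp add: good_def)
qed

section \<open>The matrix and the determinant of an automorphism\<close>

context free_group_rank
begin

lemma expsum_mult: "expsum i (u \<cdot> v) = expsum i u + expsum i v"
  by (simp add: F_mult expsum_foldr_push)

lemma expsum_inv: "u \<in> carrier F \<Longrightarrow> expsum i (winvF u) = - expsum i u"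
  by (simp add: F_inv)

text \<open>The exponent sums of a word are its coordinates in the abelianisation, on which
  \<open>h\<close> acts linearly. Multiplicativity of \<open>ab_mat\<close> follows from
  this.\<close>

lemma expsum_hom:
  assumes h: "h \<in> hom F F" and w: "w \<in> carrier F"
  shows "expsum i (h w) = (\<Sum>j\<in>{0..<n}. expsum i (h [(j, True)]) * expsum j w)"
  using w
proof (induction w)
  case Nil
  then show ?case using h by (simp add: hom_Nil)
next
  case (Cons l w)
  have *: "l # w = [l] \<cdot> w" "fst l < n" "w \<in> carrier F" using F_Cons Cons.prems by blast+
  have l: "expsum i (h [l]) = expsum i (h [(fst l, True)]) * (if snd l then 1 else - 1)"
  proof (cases "l = (fst l, True)")
    case True
    then show ?thesis by (metis mult.right_neutral snd_conv)
  next
    case False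
    then have l: "l = inv_letter (fst l, True)" using fst_eq_cases[of l "(fst l, True)"] by auto
    then have "h [l] = winvF (h [(fst l, True)])" "\<not> snd l"
      using hom_inv_letter[OF h, of "(fst l, True)"] * by (simp, metis inv_letter_pair snd_conv)
    then show ?thesis using expsum_inv hom_mem[OF h] * by simp
  qed
  have "(\<Sum>j\<in>{0..<n}. expsum i (h [(j, True)]) * (if fst l = j then (if snd l then 1 else - 1) else 0))
    = (\<Sum>j\<in>{0..<n}. if j = fst l then expsum i (h [(j, True)]) * (if snd l then 1 else - 1) else 0)"
    by (intro sum.cong) auto
  then have "(\<Sum>j\<in>{0..<n}. expsum i (h [(j, True)]) * (if fst l = j then (if snd l then 1 else - 1) else 0))
    = expsum i (h [l])"
    using * l by simp
  moreover have "expsum i (h (l # w)) = expsum i (h [l]) + expsum i (h w)"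
    using * hom_mult[OF h, of "[l]" w] by (simp add: expsum_mult)
  ultimately show ?case
    using Cons.IH *(3) by (simp add: distrib_left sum.distrib)
qed

abbreviation M where "M \<equiv> ab_mat n"

lemma M_carrier [simp]: "M \<phi> \<in> carrier_mat n n" "dim_row (M \<phi>) = n" "dim_col (M \<phi>) = n"
  by (simp_all add: ab_mat_def)

lemma M_mult: "\<phi> \<in> carrier A \<Longrightarrow> \<psi> \<in> carrier A \<Longrightarrow> M (\<phi> \<diamondop> \<psi>) = M \<phi> * M \<psi>"
proof (rule eq_matI)
  assume \<phi>: "\<phi> \<in> carrier A" "\<psi> \<in> carrier A"
  fix i j assume "i < dim_row (M \<phi> * M \<psi>)" "j < dim_col (M \<phi> * M \<psi>)"
  then have "i < n" "j < n" by simp_all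
  then show "M (\<phi> \<diamondop> \<psi>) $$ (i, j) = (M \<phi> * M \<psi>) $$ (i, j)"
    using \<phi> expsum_hom[OF A_hom[OF \<phi>(1)], of "\<psi> [(j, True)]" i] by (simp add: ab_mat_def scalar_prod_def)
qed simp_all

lemma M_one: "M \<one>\<^bsub>A\<^esub> = 1\<^sub>m n"
  by (rule eq_matI) (auto simp: ab_mat_def)

definition dt :: "(letter list \<Rightarrow> letter list) \<Rightarrow> int" where "dt \<phi> = det (M \<phi>)"

lemma dt_mult: "\<phi> \<in> carrier A \<Longrightarrow> \<psi> \<in> carrier A \<Longrightarrow> dt (\<phi> \<diamondop> \<psi>) = dt \<phi> * dt \<psi>"
  by (simp add: dt_def M_mult det_mult[of _ n])

lemma dt_one [simp]: "dt \<one>\<^bsub>A\<^esub> = 1"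
  by (simp add: dt_def M_one)

lemma dt_inv_mult: "\<phi> \<in> carrier A \<Longrightarrow> dt \<phi> * dt (inv\<^bsub>A\<^esub> \<phi>) = 1"
  by (simp flip: dt_mult)

lemma dt_cases: "\<phi> \<in> carrier A \<Longrightarrow> dt \<phi> = 1 \<or> dt \<phi> = - 1"
  using dt_inv_mult[of \<phi>] zmult_eq_1_iff by blast

lemma dt_inv: "\<phi> \<in> carrier A \<Longrightarrow> dt (inv\<^bsub>A\<^esub> \<phi>) = dt \<phi>"
  using dt_inv_mult[of \<phi>] dt_cases[of \<phi>] by auto

lemma M_T_letter:
  assumes "avoids l u"
  shows "M (T l u) = mat n n (\<lambda>(i, j). (if i = j then 1 else 0)
    + (if j = fst l then (if snd l then 1 else - 1) * expsum i u else 0))"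
proof (rule eq_matI)
  fix i j assume "i < dim_row (mat n n (\<lambda>(i, j). (if i = j then 1 else 0)
    + (if j = fst l then (if snd l then 1 else - 1) * expsum i u else (0::int))))"
    "j < dim_col (mat n n (\<lambda>(i, j). (if i = j then 1 else 0)
    + (if j = fst l then (if snd l then 1 else - 1) * expsum i u else (0::int))))"
  then have ij: "i < n" "j < n" by simp_all
  consider "j \<noteq> fst l" | "(j, True) = l" | "(j, True) = inv_letter l"
    using fst_eq_cases[of "(j, True)" l] by force
  then have "expsum i (T l u [(j, True)]) = (if i = j then 1 else 0)
    + (if j = fst l then (if snd l then 1 else - 1) * expsum i u else 0)"
  proof cases
    case 1
    then show ?thesis using T_letter(3)[OF assms, of "(j, True)"] ij by simp
  next
    case 2
    then have "T l u [(j, True)] = [l] \<cdot> u" "fst l = j" "snd l" using T_letter(1)[OF assms] by auto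
    then show ?thesis by (simp add: expsum_mult)
  next
    case 3
    then have "l = (j, False)" by (metis inv_letter_pair inv_letter_simps(1))
    then show ?thesis using T_letter(2)[OF assms] avoidsD(2)[OF assms]
      by (simp add: expsum_mult expsum_inv)
  qed
  then show "M (T l u) $$ (i, j) = mat n n (\<lambda>(i, j). (if i = j then 1 else 0)
    + (if j = fst l then (if snd l then 1 else - 1) * expsum i u else 0)) $$ (i, j)"
    using ij by (simp add: ab_mat_def)
qed (simp_all add: ab_mat_def)

lemma M_T_addrow:
  assumes "fst l < n" "k < n" "fst l \<noteq> k" "u \<in> carrier F" "fst ` set u \<subseteq> {k}"
  shows "M (T l u) = addrow_mat n ((if snd l then 1 else - 1) * expsum k u) k (fst l)"
proof -
  have av: "avoids l u" using assms by (auto simp: avoids_def)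
  have "expsum i u = 0" if "i \<noteq> k" for i using assms(5) that by (intro expsum_avoid) auto
  then show ?thesis
    unfolding M_T_letter[OF av] using assms by (intro eq_matI) auto
qed

lemma dt_T: "fst l < n \<Longrightarrow> fst m < n \<Longrightarrow> fst l \<noteq> fst m \<Longrightarrow> dt (T l [m]) = 1"
  unfolding dt_def by (subst M_T_addrow[of l "fst m"]) (auto intro: det_addrow_mat)

lemma dt_NG: "\<phi> \<in> NG \<Longrightarrow> dt \<phi> = 1"
proof (induction rule: generate.induct)
  case (inv h)
  then have "h \<in> carrier A" "dt h = 1" using elementary_A by (blast, auto simp: elementary_def dt_T)
  then show ?case by (simp add: dt_inv)
next
  case (eng h1 h2)
  then show ?case using A.generate_in_carrier[OF elementary_A] by (simp add: dt_mult)
qed (auto simp: elementary_def dt_T)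

section \<open>Surjectivity onto SL(n,Z)\<close>

lemma replicate_mem: "k < n \<Longrightarrow> replicate m (k, b) \<in> carrier F"
proof -
  have "reduced (replicate m (k, b))"
    by (induction m) (auto simp: reduced_Cons hd_replicate)
  then show "k < n \<Longrightarrow> ?thesis" by (auto simp: mem_F)
qed

lemma addrow_mat_image:
  assumes "k < n" "l < n" "k \<noteq> l"
  shows "\<exists>\<phi>\<in>carrier A. dt \<phi> = 1 \<and> M \<phi> = addrow_mat n a k l"
proof -
  \<comment> \<open>The \<open>a\<close>-th power of the generator \<open>k\<close>, written as a
    reduced word.\<close>
  define u where "u = replicate (nat \<bar>a\<bar>) (k, 0 \<le> a)"
  have u: "u \<in> carrier F" "fst ` set u \<subseteq> {k}" using assms by (auto simp: u_def replicate_mem)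
  have "expsum k (replicate m (k, b)) = (if b then int m else - int m)" for m b
    by (induction m) auto
  then have e: "expsum k u = a" by (simp add: u_def)
  have MT: "M (T (l, True) u) = addrow_mat n a k l"
    using M_T_addrow[of "(l, True)" k u] assms u e by simp
  moreover have "T (l, True) u \<in> carrier A"
    using u assms by (intro T_mem) (auto simp: avoids_def)
  ultimately show ?thesis using det_addrow_mat[of k l n a] assms by (intro bexI[of _ "T (l, True) u"]) (simp_all add: dt_def)
qed

text \<open>Elementary matrices lift to transvections by powers of a generator, and row reduction
  brings every matrix of determinant one to the identity.\<close>

theorem SL_image:
  assumes "B \<in> carrier_mat n n" "det B = 1"
  shows "\<exists>\<phi>\<in>carrier A. dt \<phi> = 1 \<and> M \<phi> = B"
proof -
  let ?S = "{B. \<exists>\<phi>\<in>carrier A. dt \<phi> = 1 \<and> M \<phi> = B}"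
  have "B \<in> ?S"
  proof (rule SL_rowop_induct[OF _ _ assms])
    show "1\<^sub>m n \<in> ?S" using M_one by (auto intro!: bexI[of _ "\<one>\<^bsub>A\<^esub>"])
    fix B a k l assume B: "B \<in> carrier_mat n n" "k \<noteq> l" "k < n" "l < n" "addrow a k l B \<in> ?S"
    then obtain \<phi> where \<phi>: "\<phi> \<in> carrier A" "dt \<phi> = 1" "M \<phi> = addrow_mat n a k l * B"
      by (auto simp: addrow_mat[OF B(1)])
    obtain \<psi> where \<psi>: "\<psi> \<in> carrier A" "dt \<psi> = 1" "M \<psi> = addrow_mat n (- a) k l"
      using addrow_mat_image[of k l "- a"] B by blast
    have "M (\<psi> \<diamondop> \<phi>) = addrow_mat n (- a) k l * (addrow_mat n a k l * B)"
      using \<phi> \<psi> by (simp add: M_mult)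
    also have "\<dots> = addrow_mat n (- a) k l * addrow_mat n a k l * B"
      using B by (simp add: assoc_mult_mat[of _ n n _ n _ n])
    also have "\<dots> = B" using addrow_mat_inv[of k n l "- a"] B by simp
    finally show "B \<in> ?S" using \<phi> \<psi> by (auto simp: dt_mult intro!: bexI[of _ "\<psi> \<diamondop> \<phi>"])
  qed
  then show ?thesis by simp
qed

section \<open>Signed permutations of determinant one, and Nielsen's theorem\<close>

text \<open>A lift of the factorisation of a quarter turn into three elementary matrices:
  \<open>l\<close> goes to \<open>m\<close> and \<open>m\<close> to the inverse of \<open>l\<close>.
  The square inverts both.\<close>

definition W :: "letter \<Rightarrow> letter \<Rightarrow> letter list \<Rightarrow> letter list" where
  "W l m = T l [m] \<diamondop> (T m [inv_letter l] \<diamondop> T (inv_letter l) [inv_letter m])"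

lemma W_props:
  assumes "fst l < n" "fst m < n" "fst l \<noteq> fst m"
  shows "W l m \<in> NG" "W l m \<in> carrier A" "W l m [l] = [m]" "W l m [m] = [inv_letter l]"
    "\<And>x. fst x < n \<Longrightarrow> fst x \<noteq> fst l \<Longrightarrow> fst x \<noteq> fst m \<Longrightarrow> W l m [x] = [x]"
proof -
  have T: "T l [m] \<in> carrier A" "T m [inv_letter l] \<in> carrier A" "T (inv_letter l) [inv_letter m] \<in> carrier A"
    using assms by (auto intro: T_mem)
  show "W l m \<in> NG" unfolding W_def using assms by (auto intro!: generate.eng T_NG)
  show "W l m \<in> carrier A" unfolding W_def using T by simp
  have l: "T (inv_letter l) [inv_letter m] [l] = [m] \<cdot> [l]"
    using T_letter(2)[of "inv_letter l" "[inv_letter m]"] assms by simp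
  have l2: "T m [inv_letter l] [l] = [l]" "T m [inv_letter l] [m] = [m] \<cdot> [inv_letter l]"
    "T l [m] [m] = [m]" "T l [m] [l] = [l] \<cdot> [m]" "T (inv_letter l) [inv_letter m] [m] = [m]"
    using T_letter(1)[of m "[inv_letter l]"] T_letter(3)[of m "[inv_letter l]" l]
      T_letter(1)[of l "[m]"] T_letter(3)[of l "[m]" m] T_letter(3)[of "inv_letter l" "[inv_letter m]" m] assms by simp_all
  have "[m] \<cdot> [inv_letter l] \<cdot> [l] = [m]"
    using F.m_assoc[of "[m]" "[inv_letter l]" "[l]"] F_inv_cancel(2)[of "[l]"] assms by simp
  then show "W l m [l] = [m]" unfolding W_def using T assms l l2 by simp
  have "T l [m] [inv_letter l] = [inv_letter m] \<cdot> [inv_letter l]"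
    using T_letter(2)[of l "[m]"] assms by simp
  then show "W l m [m] = [inv_letter l]" unfolding W_def
    using T assms l2 F_inv_cancel'(1)[of "[m]" "[inv_letter l]"] by simp
  show "W l m [x] = [x]" if "fst x < n" "fst x \<noteq> fst l" "fst x \<noteq> fst m" for x
    unfolding W_def using T assms that T_letter(3)[of m "[inv_letter l]" x]
      T_letter(3)[of l "[m]" x] T_letter(3)[of "inv_letter l" "[inv_letter m]" x] by simp
qed

lemma dt_invert_one:
  assumes \<phi>: "\<phi> [(d, True)] = [(d, False)]" "d < n"
    and "\<And>i. i < n \<Longrightarrow> i \<noteq> d \<Longrightarrow> \<phi> [(i, True)] = [(i, True)]"
  shows "dt \<phi> = - 1"
proof -
  have "M \<phi> = multrow_mat n d (- 1)"
  proof (rule eq_matI)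
    fix i j assume "i < dim_row (multrow_mat n d (- 1 :: int))" "j < dim_col (multrow_mat n d (- 1 :: int))"
    then show "M \<phi> $$ (i, j) = multrow_mat n d (- 1) $$ (i, j)"
      using assms by (cases "j = d") (auto simp: ab_mat_def)
  qed (simp_all add: ab_mat_def)
  then show ?thesis using det_multrow_mat[of d n "- 1 :: int"] assms by (simp add: dt_def)
qed

text \<open>Induction on the number of generators not fixed. If one goes to a different generator,
  some \<open>W\<close> repairs it; if all go to themselves up to sign, squares of \<open>W\<close>
  remove inversions in pairs. A single remaining inversion would have determinant -1.\<close>

lemma lettery_NG:
  assumes "\<phi> \<in> carrier A" "lettery \<phi>" "dt \<phi> = 1"
  shows "\<phi> \<in> NG"
  using assms
proof (induction "card {i. i < n \<and> \<phi> [(i, True)] \<noteq> [(i, True)]}" arbitrary: \<phi> rule: less_induct)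
  case less
  note \<phi> = less.prems
  have step: "\<phi> \<in> NG"
    if \<psi>: "\<psi> \<in> NG" and le: "lettery (\<phi> \<diamondop> \<psi>)"
      and sub: "{i. i < n \<and> (\<phi> \<diamondop> \<psi>) [(i, True)] \<noteq> [(i, True)]} \<subset> {i. i < n \<and> \<phi> [(i, True)] \<noteq> [(i, True)]}" for \<psi>
  proof -
    have \<psi>A: "\<psi> \<in> carrier A" using \<psi> A.generate_in_carrier[OF elementary_A] by blast
    have "\<phi> \<diamondop> \<psi> \<in> NG"
      using psubset_card_mono[OF _ sub] \<phi> \<psi> \<psi>A le by (intro less.hyps) (auto simp: dt_mult dt_NG)
    then have "(\<phi> \<diamondop> \<psi>) \<diamondop> inv\<^bsub>A\<^esub> \<psi> \<in> NG"
      using \<psi> NG_subgroup by (meson subgroup.m_closed subgroup.m_inv_closed)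
    then show ?thesis using \<phi> \<psi>A by (simp add: A.m_assoc)
  qed
  have le_mult: "lettery (\<phi> \<diamondop> \<psi>)" if \<psi>: "\<psi> \<in> carrier A" "lettery \<psi>" for \<psi>
    unfolding lettery_def
  proof (intro allI impI)
    fix l :: letter assume l: "fst l < n"
    obtain m where m: "\<psi> [l] = [m]" using \<psi>(2) l by (metis lettery_def)
    then have "fst m < n" using A_mem[OF \<psi>(1), of "[l]"] l by simp
    then show "\<exists>q. (\<phi> \<diamondop> \<psi>) [l] = [q]" using \<phi> \<psi> l m by (auto simp: lettery_def simp del: split_paired_All split_paired_Ex)
  qed
  have W_le: "lettery (W l m)" if lm: "fst l < n" "fst m < n" "fst l \<noteq> fst m" for l m
    unfolding lettery_def
  proof (intro allI impI)
    fix x :: letter assume x: "fst x < n"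
    consider "x = l" | "x = inv_letter l" | "x = m" | "x = inv_letter m" | "fst x \<noteq> fst l" "fst x \<noteq> fst m"
      using fst_eq_cases by blast
    then show "\<exists>q. W l m [x] = [q]"
      using W_props[OF lm] lm x A_inv_letter[OF W_props(2)[OF lm], of l] A_inv_letter[OF W_props(2)[OF lm], of m]
      by cases auto
  qed
  show ?case
  proof (cases "\<exists>i j b. i < n \<and> \<phi> [(i, True)] = [(j, b)] \<and> i \<noteq> j")
    case True
    then obtain i j b where i: "i < n" "\<phi> [(i, True)] = [(j, b)]" "i \<noteq> j" by blast
    \<comment> \<open>With \<open>m\<close> the preimage of the generator \<open>i\<close>, the
      composite of \<phi> with \<open>W l m\<close> fixes \<open>i\<close>.\<close>
    obtain m where m: "fst m < n" "\<phi> [m] = [(i, True)]"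
      using lettery_onto[OF \<phi>(1,2), of "(i, True)"] i by auto
    have mi: "fst m \<noteq> i"
    proof
      assume "fst m = i"
      then have "m = (i, True) \<or> m = inv_letter (i, True)" using fst_eq_cases[of m "(i, True)"] by simp
      then show False using m i A_inv_letter[OF \<phi>(1), of "(i, True)"] A_mem[OF \<phi>(1), of "[(i, True)]"] by auto
    qed
    define l where "l = (i, True)"
    have lm: "fst l < n" "fst m < n" "fst l \<noteq> fst m" using i m mi by (auto simp: l_def)
    note W = W_props[OF lm]
    \<comment> \<open>The generator of \<open>m\<close>, whose image also changes, was not fixed
      before, so no fixed generator is lost.\<close>
    have mm: "\<phi> [(fst m, True)] \<noteq> [(fst m, True)]"
    proof
      assume *: "\<phi> [(fst m, True)] = [(fst m, True)]"
      have "m = (fst m, True) \<or> m = inv_letter (fst m, True)" by (rule fst_eq_cases) simp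
      then have "\<phi> [m] = [m]" using * A_inv_letter[OF \<phi>(1), of "(fst m, True)"] m by auto
      then have "m = (i, True)" using m by simp
      then show False using mi by (metis fst_conv)
    qed
    have "{k. k < n \<and> (\<phi> \<diamondop> W l m) [(k, True)] \<noteq> [(k, True)]} \<subseteq> {k. k < n \<and> \<phi> [(k, True)] \<noteq> [(k, True)]} - {i}"
    proof (safe, goal_cases)
      case (1 k)
      then have "k \<noteq> i" using W \<phi> m i by (auto simp: l_def)
      moreover have "k \<noteq> fst m" using 1 mm by auto
      ultimately show ?case using 1 W(5)[of "(k, True)"] \<phi> W(2) by (auto simp: l_def)
    next
      case (2 k)
      then show ?case using W \<phi> m i by (auto simp: l_def)
    qed
    moreover have "i \<in> {k. k < n \<and> \<phi> [(k, True)] \<noteq> [(k, True)]}" using i by simp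
    ultimately have "{k. k < n \<and> (\<phi> \<diamondop> W l m) [(k, True)] \<noteq> [(k, True)]} \<subset> {k. k < n \<and> \<phi> [(k, True)] \<noteq> [(k, True)]}"
      by blast
    then show ?thesis by (rule step[OF W(1) le_mult[OF W(2) W_le[OF lm]]])
  next
    case False
    have sgn: "\<phi> [(i, True)] = [(i, True)] \<or> \<phi> [(i, True)] = [(i, False)]" if i: "i < n" for i
    proof -
      obtain q where "\<phi> [(i, True)] = [q]" using \<phi>(2) i unfolding lettery_def by (metis fst_conv)
      then show ?thesis using False i by (cases q; cases "snd q") auto
    qed
    show ?thesis
    proof (cases "\<exists>i m. i < n \<and> m < n \<and> i \<noteq> m \<and> \<phi> [(i, True)] = [(i, False)] \<and> \<phi> [(m, True)] = [(m, False)]")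
      case True
      then obtain i j where ij: "i < n" "j < n" "i \<noteq> j" "\<phi> [(i, True)] = [(i, False)]" "\<phi> [(j, True)] = [(j, False)]"
        by blast
      define l m where "l = (i, True)" "m = (j, True)"
      have lm: "fst l < n" "fst m < n" "fst l \<noteq> fst m" using ij by (auto simp: l_m_def)
      note W = W_props[OF lm]
      have W2: "W l m \<diamondop> W l m \<in> carrier A" "W l m \<diamondop> W l m \<in> NG" using W(1,2) by (auto intro: generate.eng)
      have inv: "W l m [inv_letter l] = [inv_letter m]" "\<phi> [inv_letter l] = [l]" "\<phi> [inv_letter m] = [m]"
        using A_inv_letter[OF W(2), of l] W lm A_inv_letter[OF \<phi>(1), of l] A_inv_letter[OF \<phi>(1), of m] ij
        by (auto simp: l_m_def)
      have fix2: "(\<phi> \<diamondop> (W l m \<diamondop> W l m)) [l] = [l]" "(\<phi> \<diamondop> (W l m \<diamondop> W l m)) [m] = [m]"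
        using W W2 inv \<phi> lm by auto
      have "{k. k < n \<and> (\<phi> \<diamondop> (W l m \<diamondop> W l m)) [(k, True)] \<noteq> [(k, True)]} \<subseteq> {k. k < n \<and> \<phi> [(k, True)] \<noteq> [(k, True)]} - {i}"
      proof (safe, goal_cases)
        case (1 k)
        then have "k \<noteq> i" "k \<noteq> j" using fix2 by (auto simp: l_m_def)
        then show ?case using 1 W(5)[of "(k, True)"] \<phi> W W2 by (auto simp: l_m_def)
      next
        case (2 k)
        then show ?case using fix2 by (auto simp: l_m_def)
      qed
      moreover have "i \<in> {k. k < n \<and> \<phi> [(k, True)] \<noteq> [(k, True)]}" using ij by simp
      ultimately have sub: "{k. k < n \<and> (\<phi> \<diamondop> (W l m \<diamondop> W l m)) [(k, True)] \<noteq> [(k, True)]} \<subset> {k. k < n \<and> \<phi> [(k, True)] \<noteq> [(k, True)]}"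
        by blast
      have "lettery (\<phi> \<diamondop> (W l m \<diamondop> W l m))"
        unfolding lettery_def
      proof (intro allI impI)
        fix x :: letter assume x: "fst x < n"
        obtain y where y: "W l m [x] = [y]" using W_le[OF lm] x by (metis lettery_def)
        then have yn: "fst y < n" using A_mem[OF W(2), of "[x]"] x by simp
        obtain z where z: "W l m [y] = [z]" using W_le[OF lm] yn by (metis lettery_def)
        then have zn: "fst z < n" using A_mem[OF W(2), of "[y]"] yn by simp
        obtain q where "\<phi> [z] = [q]" using \<phi>(2) zn by (metis lettery_def)
        then have "(\<phi> \<diamondop> (W l m \<diamondop> W l m)) [x] = [q]" using \<phi> W(2) W2 x y z by simp
        then show "\<exists>q. (\<phi> \<diamondop> (W l m \<diamondop> W l m)) [x] = [q]" by blast
      qed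
      then show ?thesis using step[OF W2(2) _ sub] by blast
    next
      case nontwo: False
      show ?thesis
      proof (cases "\<exists>d<n. \<phi> [(d, True)] = [(d, False)]")
        case True
        then obtain d where d: "d < n" "\<phi> [(d, True)] = [(d, False)]" by blast
        have "dt \<phi> = - 1"
          using d sgn nontwo by (intro dt_invert_one[of \<phi> d]) blast+
        then show ?thesis using \<phi> by simp
      next
        case False
        then have "\<phi> = \<one>\<^bsub>A\<^esub>" using sgn \<phi> by (intro A_eqI) (auto intro: exI[of _ True])
        then show ?thesis by (simp add: generate.one)
      qed
    qed
  qed
qed

text \<open>Nielsen reduction leaves a signed permutation. The transvections used have determinant
  one, so it has determinant one as well and \<open>lettery_NG\<close> applies.\<close>

theorem NG_eq: "NG = {\<phi> \<in> carrier A. dt \<phi> = 1}"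
proof safe
  fix \<phi> assume "\<phi> \<in> NG"
  then show "\<phi> \<in> carrier A" "dt \<phi> = 1"
    using A.generate_in_carrier[OF elementary_A] dt_NG by blast+
next
  fix \<phi> assume \<phi>: "\<phi> \<in> carrier A" "dt \<phi> = 1"
  obtain \<psi> where \<psi>: "\<psi> \<in> NG" "lettery (\<phi> \<diamondop> \<psi>)" using nielsen_reduction[OF \<phi>(1)] by blast
  have \<psi>A: "\<psi> \<in> carrier A" using \<psi> A.generate_in_carrier[OF elementary_A] by blast
  have "\<phi> \<diamondop> \<psi> \<in> NG" using \<phi> \<psi> \<psi>A by (intro lettery_NG) (auto simp: dt_mult dt_NG)
  then have "(\<phi> \<diamondop> \<psi>) \<diamondop> inv\<^bsub>A\<^esub> \<psi> \<in> NG"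
    using \<psi> NG_subgroup by (meson subgroup.m_closed subgroup.m_inv_closed)
  then show "\<phi> \<in> NG" using \<phi> \<psi>A by (simp add: A.m_assoc)
qed

end

section \<open>Five elements of order k\<close>

text \<open>The product of \<open>B\<close> cycles of length \<open>k\<close> on consecutive
  intervals, the first of which starts at \<open>s\<close>; all other numbers are fixed.\<close>

definition block_cycle :: "nat \<Rightarrow> nat \<Rightarrow> nat \<Rightarrow> nat \<Rightarrow> nat" where
  "block_cycle k s B i = (if s \<le> i \<and> i < s + B * k
     then s + (i - s) div k * k + ((i - s) mod k + 1) mod k else i)"

lemma block_cycle_outside: "i < s \<or> s + B * k \<le> i \<Longrightarrow> block_cycle k s B i = i"
  by (auto simp: block_cycle_def)

lemma block_cycle_inside:
  assumes "q < B" "t < k"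
  shows "block_cycle k s B (s + q * k + t) = s + q * k + (t + 1) mod k"
proof -
  have "q * k + t < Suc q * k" using assms by simp
  also have "\<dots> \<le> B * k" using assms by (intro mult_le_mono1) simp
  finally show ?thesis using assms by (simp add: block_cycle_def)
qed

lemma block_cycle_next:
  assumes "s \<le> i" "i < s + B * k" "(i - s) mod k \<noteq> k - 1" "k > 0"
  shows "block_cycle k s B i = Suc i"
proof -
  have "(i - s) mod k < k" using assms by simp
  then have "Suc ((i - s) mod k) < k" using assms(3) by linarith
  then have "block_cycle k s B i = s + ((i - s) div k * k + (i - s) mod k) + 1"
    using assms by (simp add: block_cycle_def)
  then show ?thesis using assms by (simp only: div_mult_mod_eq)
qed

lemma block_cycle_funpow:
  assumes "q < B" "t < k"
  shows "(block_cycle k s B ^^ j) (s + q * k + t) = s + q * k + (t + j) mod k"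
proof (induction j)
  case (Suc j)
  have "(t + j) mod k < k" using assms by simp
  from block_cycle_inside[OF assms(1) this, of s] Suc show ?case
    using assms by (simp add: mod_Suc_eq)
qed (use assms in simp)

lemma block_cycle_cases:
  fixes i s B k :: nat
  assumes "k > 0"
  obtains "i < s \<or> s + B * k \<le> i" | q t where "q < B" "t < k" "i = s + q * k + t"
proof (cases "s \<le> i \<and> i < s + B * k")
  case True
  then have "(i - s) div k < B" "(i - s) mod k < k" "i = s + (i - s) div k * k + (i - s) mod k"
    using assms by (auto simp: less_mult_imp_div_less div_mult_mod_eq add.assoc)
  then show ?thesis using that(2) by blast
qed (use that(1) in auto)

lemma block_cycle_funpow_k:
  assumes "k > 0"
  shows "(block_cycle k s B ^^ k) i = i"
proof (cases rule: block_cycle_cases[OF assms, of i s B])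
  case 1
  then have "(block_cycle k s B ^^ j) i = i" for j by (induction j) (auto simp: block_cycle_outside)
  then show ?thesis .
next
  case (2 q t)
  then show ?thesis using block_cycle_funpow[of q B t k k s] by simp
qed

lemma block_cycle_bij:
  assumes "k > 0" "s + B * k \<le> n"
  shows "bij_betw (block_cycle k s B) {..<n} {..<n}"
proof -
  let ?f = "block_cycle k s B"
  have sub: "?f i < n" if "i < n" for i
  proof (cases rule: block_cycle_cases[OF assms(1), of i s B])
    case 1
    then show ?thesis using that by (simp add: block_cycle_outside)
  next
    case (2 q t)
    have "q * k + (t + 1) mod k < Suc q * k" using assms by simp
    also have "\<dots> \<le> B * k" using 2 by (intro mult_le_mono1) simp
    finally show ?thesis using 2 block_cycle_inside[of q B t k s] assms by simp
  qed
  then have sub': "(?f ^^ j) i < n" if "i < n" for i j using that by (induction j) auto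
  have id: "(?f ^^ (k - 1)) (?f i) = i" "?f ((?f ^^ (k - 1)) i) = i" for i
    using block_cycle_funpow_k[OF assms(1), of s B i] assms(1)
    by (metis Suc_diff_1 comp_apply funpow_Suc_right, metis Suc_diff_1 comp_apply funpow.simps(2))
  show ?thesis
    by (rule bij_betw_byWitness[where f' = "?f ^^ (k - 1)"]) (use id sub sub' in auto)
qed

lemma (in group) conj_pow:
  assumes "x \<in> carrier G" "y \<in> carrier G"
  shows "(x \<otimes> y \<otimes> inv x) [^] (m::nat) = x \<otimes> y [^] m \<otimes> inv x"
proof (induction m)
  case (Suc m)
  have "inv x \<otimes> (x \<otimes> z) = z" if "z \<in> carrier G" for z
    using assms that by (simp flip: m_assoc)
  then show ?case using Suc assms by (simp add: m_assoc)
qed (use assms in simp)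

section \<open>Automorphisms of order k from cycles\<close>

context free_group_rank
begin

text \<open>Only the fixed point \<open>d\<close> of \<open>f\<close> can carry a sign, so signs do
  not accumulate along the other orbits.\<close>

lemma sperm_pow:
  assumes f: "bij_betw f {..<n} {..<n}" and d: "d < n" "f d = d" and e: "\<And>i. i \<noteq> d \<Longrightarrow> e i" and i: "i < n"
  shows "(sperm f e [^]\<^bsub>A\<^esub> j) [(i, b)] = [((f ^^ j) i, b = (i \<noteq> d \<or> e d \<or> even (j::nat)))]"
proof (induction j)
  case 0
  then show ?case using i by simp
next
  case (Suc j)
  have fn: "f ` {..<n} \<subseteq> {..<n}" using f by (auto simp: bij_betw_def)
  then have fj: "(f ^^ j) i < n" using i by (induction j) auto
  have "f x \<noteq> d" if "x < n" "x \<noteq> d" for x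
    using f d that unfolding bij_betw_def inj_on_def by (metis lessThan_iff)
  then have ne: "(f ^^ j) i \<noteq> d \<and> (f ^^ j) i < n" if "i \<noteq> d" using that i fn by (induction j) auto
  have eq: "(f ^^ j) i = d" if "i = d" using that d by (induction j) auto
  have p: "sperm f e \<in> carrier A" by (rule sperm_mem[OF f])
  have "sperm f e [^]\<^bsub>A\<^esub> Suc j = sperm f e \<diamondop> sperm f e [^]\<^bsub>A\<^esub> j"
    using A.nat_pow_Suc2[OF p] by simp
  then have "(sperm f e [^]\<^bsub>A\<^esub> Suc j) [(i, b)] = sperm f e [((f ^^ j) i, b = (i \<noteq> d \<or> e d \<or> even j))]"
    using Suc p i by simp
  also have "\<dots> = [(f ((f ^^ j) i), (b = (i \<noteq> d \<or> e d \<or> even j)) = e ((f ^^ j) i))]"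
    using fj by (simp add: sperm_letter[OF fn])
  finally show ?case using ne eq e d by (cases "i = d") auto
qed

text \<open>A product of \<open>k\<close>-cycles on the generators; if it has determinant \<open>-1\<close> (then \<open>k\<close> is even),
  the fixed generator \<open>d\<close> is inverted in addition, which does not change the order.\<close>
definition cycle_aut :: "nat \<Rightarrow> nat \<Rightarrow> nat \<Rightarrow> nat \<Rightarrow> letter list \<Rightarrow> letter list" where
  "cycle_aut k s B d = sperm (block_cycle k s B)
     (\<lambda>i. i \<noteq> d \<or> dt (sperm (block_cycle k s B) (\<lambda>_. True)) = 1)"

text \<open>The last two conclusions give the order: the \<open>k\<close>-th power is trivial, and
  no smaller positive power is trivial even on the abelianisation, so the order survives in the
  quotients.\<close>

lemma cycle_aut_props:
  assumes k: "k > 0" and sB: "s + B * k \<le> n" "B > 0" and d: "d < n" "d < s \<or> s + B * k \<le> d"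
  shows "cycle_aut k s B d \<in> carrier A" "lettery (cycle_aut k s B d)" "dt (cycle_aut k s B d) = 1"
    "\<And>i b. i < n \<Longrightarrow> i \<noteq> d \<Longrightarrow> cycle_aut k s B d [(i, b)] = [(block_cycle k s B i, b)]"
    "\<And>i b. i < n \<Longrightarrow> \<exists>b'. cycle_aut k s B d [(i, b)] = [(block_cycle k s B i, b')]"
    "cycle_aut k s B d [^]\<^bsub>A\<^esub> k = \<one>\<^bsub>A\<^esub>"
    "\<And>j::nat. M (cycle_aut k s B d [^]\<^bsub>A\<^esub> j) = 1\<^sub>m n \<Longrightarrow> k dvd j"
proof -
  let ?f = "block_cycle k s B"
  note bij = block_cycle_bij[OF k sB(1)]
  have fn: "?f ` {..<n} \<subseteq> {..<n}" using bij by (auto simp: bij_betw_def)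
  have fd: "?f d = d" using d by (simp add: block_cycle_outside)
  define p where "p = sperm ?f (\<lambda>_. True)"
  define e where "e i \<longleftrightarrow> i \<noteq> d \<or> dt p = 1" for i
  have c: "cycle_aut k s B d = sperm ?f e" by (simp add: cycle_aut_def e_def[abs_def] p_def)
  have e: "e i" if "i \<noteq> d" for i using that by (simp add: e_def)
  have pA: "p \<in> carrier A" unfolding p_def by (rule sperm_mem[OF bij])
  have pw: "(sperm ?f e [^]\<^bsub>A\<^esub> j) [(i, b)] = [((?f ^^ j) i, b = (i \<noteq> d \<or> e d \<or> even j))]"
    if "i < n" for i b and j :: nat
    by (rule sperm_pow[OF bij d(1) fd e that])
  show cA: "cycle_aut k s B d \<in> carrier A" unfolding c by (rule sperm_mem[OF bij])
  show "lettery (cycle_aut k s B d)" unfolding c by (rule sperm_lettery[OF fn])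
  show "cycle_aut k s B d [(i, b)] = [(?f i, b)]" if "i < n" "i \<noteq> d" for i b
    unfolding c using that e by (simp add: sperm_letter[OF fn])
  show "\<exists>b'. cycle_aut k s B d [(i, b)] = [(?f i, b')]" if "i < n" for i b
    unfolding c using that by (simp add: sperm_letter[OF fn])
  show "dt (cycle_aut k s B d) = 1"
  proof (cases "dt p = 1")
    case True
    then have "e = (\<lambda>_. True)" by (auto simp: e_def)
    then show ?thesis using True c p_def by simp
  next
    case False
    then have dp: "dt p = - 1" "\<not> e d" using dt_cases[OF pA] by (auto simp: e_def)
    \<comment> \<open>Inverting \<open>d\<close> alone has determinant -1, which corrects the
      determinant of \<open>p\<close>.\<close>
    define q where "q = sperm (\<lambda>i. i) (\<lambda>i. i \<noteq> d)"
    have qA: "q \<in> carrier A" unfolding q_def by (rule sperm_mem) (simp add: bij_betw_def)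
    have ql: "q [(i, b)] = [(i, b = (i \<noteq> d))]" if "i < n" for i b
      unfolding q_def using that by (subst sperm_letter) auto
    have "dt q = - 1" using dt_invert_one[of q d] ql d by auto
    moreover have "cycle_aut k s B d = p \<diamondop> q"
    proof (rule A_eqI[OF cA])
      fix i assume "i < n"
      then show "\<exists>b. cycle_aut k s B d [(i, b)] = (p \<diamondop> q) [(i, b)]"
        using pA qA ql dp e unfolding c by (auto simp: p_def sperm_letter[OF fn])
    qed (use pA qA in simp)
    ultimately show ?thesis using dp pA qA by (simp add: dt_mult)
  qed
  have pk: "p [^]\<^bsub>A\<^esub> k = \<one>\<^bsub>A\<^esub>"
    using pA sperm_pow[OF bij d(1) fd, of "\<lambda>_. True" _ k] block_cycle_funpow_k[OF k]
    by (intro A_eqI) (auto simp: p_def)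
  have "dt (p [^]\<^bsub>A\<^esub> j) = dt p ^ j" for j :: nat
    using pA by (induction j) (auto simp: dt_mult)
  from this[of k] have "dt p ^ k = 1" by (simp add: pk)
  \<comment> \<open>For odd \<open>k\<close> the relation \<open>dt p ^ k = 1\<close> forces
    determinant 1, so a sign at \<open>d\<close> occurs only for even \<open>k\<close> and
    disappears in the \<open>k\<close>-th power.\<close>
  then have ev: "even k \<or> e d" using dt_cases[OF pA] by (cases "even k") (auto simp: e_def)
  show "cycle_aut k s B d [^]\<^bsub>A\<^esub> k = \<one>\<^bsub>A\<^esub>"
    using cA block_cycle_funpow_k[OF k] ev by (intro A_eqI) (auto simp: c pw)
  fix j :: nat assume M1: "M (cycle_aut k s B d [^]\<^bsub>A\<^esub> j) = 1\<^sub>m n"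
  have s: "s < n" "s \<noteq> d"
  proof -
    have "k \<le> B * k" using sB(2) by simp
    then show "s < n" "s \<noteq> d" using sB(1) k d by linarith+
  qed
  have "(cycle_aut k s B d [^]\<^bsub>A\<^esub> j) [(s, True)] = [((?f ^^ j) s, True)]"
    using s by (simp add: c pw)
  \<comment> \<open>The first point of the first block returns to itself only after a multiple of
    \<open>k\<close> steps, and the diagonal entry at \<open>s\<close> records this.\<close>
  moreover have "(?f ^^ j) s = s + j mod k"
    using block_cycle_funpow[of 0 B 0 k j s] k sB by simp
  ultimately have "M (cycle_aut k s B d [^]\<^bsub>A\<^esub> j) $$ (s, s) = (if j mod k = 0 then 1 else 0)"
    using s by (simp add: ab_mat_def)
  then show "k dvd j" using M1 s by (auto split: if_splits)
qed

section \<open>Spreading transvections inside a subgroup\<close>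

lemma T_avoids:
  assumes "avoids l v" "avoids z v" "avoids z u"
  shows "avoids z (T l v u)"
proof -
  have "fst z \<notin> fst ` set (T l v u)"
  proof (rule hom_avoid[OF T_hom[OF assms(1)]])
    fix x assume "x \<in> set u"
    then have x: "fst x < n" "fst x \<noteq> fst z" using avoids_set[OF assms(3)] by auto
    consider "x = l" | "x = inv_letter l" | "fst x \<noteq> fst l" using fst_eq_cases by blast
    then have "avoids z (T l v [x])"
      by cases (use assms x avoidsD[OF assms(3)] in \<open>auto simp: T_letter\<close>)
    then show "fst z \<notin> fst ` set (T l v [x])" by (simp add: avoids_def)
  qed (use avoidsD[OF assms(3)] in simp)
  then show ?thesis
    using A_mem[OF T_mem[OF assms(1)], of u] avoidsD[OF assms(3)] by (simp add: avoids_def)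
qed

lemma T_inv_letter_mem:
  assumes "subgroup H A" "T l [m] \<in> H" "fst l < n" "fst m < n" "fst l \<noteq> fst m"
  shows "T l [inv_letter m] \<in> H"
proof -
  have "T l [inv_letter m] = inv\<^bsub>A\<^esub> (T l [m])"
    using T_inv[of l "[m]"] assms by simp
  then show ?thesis using assms by (simp add: subgroup.m_inv_closed)
qed

text \<open>Asking for the transvections on both sides makes the relation insensitive to the signs of
  signed permutations.\<close>
definition linked :: "(letter list \<Rightarrow> letter list) set \<Rightarrow> nat \<Rightarrow> nat \<Rightarrow> bool" where
  "linked H i j \<longleftrightarrow> i < n \<and> j < n \<and> i \<noteq> j \<and> (\<forall>b. T (i, b) [(j, True)] \<in> H)"

lemma linkedD:
  assumes "subgroup H A" "linked H (fst l) (fst m)"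
  shows "T l [m] \<in> H"
proof -
  have *: "fst l < n" "fst m < n" "fst l \<noteq> fst m" "T l [(fst m, True)] \<in> H"
    using assms(2) unfolding linked_def by (auto, metis prod.collapse)
  consider "m = (fst m, True)" | "m = inv_letter (fst m, True)"
    using fst_eq_cases[of m "(fst m, True)"] by auto
  then show ?thesis
    using *(4) T_inv_letter_mem[OF assms(1), of l "(fst m, True)"] * by cases auto
qed

lemma linked_trans:
  assumes "subgroup H A" "linked H i j" "linked H j p" "i \<noteq> p"
  shows "linked H i p"
  using assms T_trans[OF assms(1), of "(i, b)" "(j, True)" "(p, True)" for b]
  by (auto simp: linked_def)

lemma linked_image:
  assumes H: "subgroup H A" and s: "s \<in> H" "lettery s"
    and i: "s [(i, True)] = [(i', b)]" and j: "s [(j, True)] = [(j', c)]" and ij: "linked H i j"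
  shows "linked H i' j'"
proof -
  have sA: "s \<in> carrier A" using H s by (meson subgroup.mem_carrier)
  have n: "i < n" "j < n" "i \<noteq> j" using ij by (auto simp: linked_def)
  have n': "i' < n" "j' < n" using A_mem[OF sA, of "[(i, True)]"] A_mem[OF sA, of "[(j, True)]"] i j n by auto
  have i2: "s [(i, False)] = [(i', \<not> b)]" using A_inv_letter[OF sA, of "(i, True)"] i n n' by simp
  have *: "T (i', b') [(j', c)] \<in> H" "i' \<noteq> j'" for b'
  proof -
    \<comment> \<open>The sign of the source letter is chosen so that its image has the prescribed
      sign \<open>b'\<close>.\<close>
    define l where "l = (i, b' = b)"
    have l: "s [l] = [(i', b')]" using i i2 by (cases b; cases b') (simp_all add: l_def)
    have av: "avoids l [(j, True)]" using n by (simp add: l_def)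
    have "T l [(j, True)] \<in> H" using linkedD[OF H, of l "(j, True)"] ij by (simp add: l_def)
    then have "s \<diamondop> T l [(j, True)] \<diamondop> inv\<^bsub>A\<^esub> s \<in> H"
      using H s by (simp add: subgroup.m_closed subgroup.m_inv_closed)
    then show "T (i', b') [(j', c)] \<in> H" using lettery_conj[OF sA s(2) l av] j by simp
    show "i' \<noteq> j'" using lettery_conj(1)[OF sA s(2) l av] j by simp
  qed
  have "T (i', b') [(j', True)] \<in> H" for b'
    using *(1)[of b'] T_inv_letter_mem[OF H *(1)[of b']] n' *(2) by (cases c) auto
  then show ?thesis using n' *(2) by (simp add: linked_def)
qed

lemma T_mult': "avoids l u \<Longrightarrow> avoids l v \<Longrightarrow> \<psi> \<in> carrier A \<Longrightarrow> T l u \<diamondop> (T l v \<diamondop> \<psi>) = T l (u \<cdot> v) \<diamondop> \<psi>"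
  by (simp add: T_mem T_mult flip: A.m_assoc)

text \<open>The given element maps \<open>z\<close> to \<open>v\<^sup>-\<^sup>1 z u\<close>, and
  conjugation by \<phi>, which fixes \<open>z\<close>, applies \<phi> to \<open>u\<close> and
  \<open>v\<close>. In a quotient of the two, the side on which \<phi> acts trivially cancels and a
  one-sided transvection is left.\<close>

lemma commutator_step:
  assumes H: "subgroup H A" and z: "avoids z u" "avoids z v"
    and g: "T z u \<diamondop> T (inv_letter z) v \<in> H"
    and \<phi>: "\<phi> \<in> H" "\<phi> [z] = [z]" "\<And>x. fst x < n \<Longrightarrow> fst x \<noteq> fst z \<Longrightarrow> avoids z (\<phi> [x])"
  shows "\<phi> v = v \<Longrightarrow> T z (\<phi> u \<cdot> winvF u) \<in> H" "\<phi> u = u \<Longrightarrow> T (inv_letter z) (winvF v \<cdot> \<phi> v) \<in> H"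
proof -
  let ?z = "inv_letter z"
  let ?g = "T z u \<diamondop> T ?z v"
  have \<phi>A: "\<phi> \<in> carrier A" using H \<phi> by (meson subgroup.mem_carrier)
  note n = avoidsD[OF z(1)] avoidsD[OF z(2)]
  have z': "\<phi> [?z] = [?z]" using A_inv_letter[OF \<phi>A, of z] \<phi>(2) n by simp
  have av: "avoids z (\<phi> u)" "avoids z (\<phi> v)"
    using A_conj(1)[OF \<phi>A z(1) \<phi>(2,3)] A_conj(1)[OF \<phi>A z(2) \<phi>(2,3)] by blast+
  have "\<phi> \<diamondop> T z u = T z (\<phi> u) \<diamondop> \<phi>" "\<phi> \<diamondop> T ?z v = T ?z (\<phi> v) \<diamondop> \<phi>"
    using A_conj(2)[OF \<phi>A z(1) \<phi>(2,3)] A_conj(2)[OF \<phi>A _ z', of v] z \<phi>(3) by simp_all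
  then have "\<phi> \<diamondop> ?g = T z (\<phi> u) \<diamondop> T ?z (\<phi> v) \<diamondop> \<phi>"
    using \<phi>A z av by (simp add: T_mem A.m_assoc flip: A.m_assoc[of \<phi>])
  then have conj: "\<phi> \<diamondop> ?g \<diamondop> inv\<^bsub>A\<^esub> \<phi> = T z (\<phi> u) \<diamondop> T ?z (\<phi> v)"
    using \<phi>A z av by (simp add: T_mem A.m_assoc)
  have inH: "T z (\<phi> u) \<diamondop> T ?z (\<phi> v) \<in> H"
    using H \<phi>(1) g by (metis conj subgroup.m_closed subgroup.m_inv_closed)
  have ginv: "inv\<^bsub>A\<^esub> ?g = T ?z (winvF v) \<diamondop> T z (winvF u)"
    using z by (simp add: A.inv_mult_group T_mem T_inv)
  have ginH: "T ?z (winvF v) \<diamondop> T z (winvF u) \<in> H"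
    using H g ginv by (metis subgroup.m_inv_closed)
  show "T z (\<phi> u \<cdot> winvF u) \<in> H" if "\<phi> v = v"
  proof -
    have "(T z (\<phi> u) \<diamondop> T ?z (\<phi> v)) \<diamondop> (T ?z (winvF v) \<diamondop> T z (winvF u)) \<in> H"
      using H inH ginH by (rule subgroup.m_closed)
    then show ?thesis
      using that z av n by (simp add: A.m_assoc T_mem T_mult T_mult' T_Nil)
  qed
  show "T ?z (winvF v \<cdot> \<phi> v) \<in> H" if "\<phi> u = u"
  proof -
    have "(T ?z (winvF v) \<diamondop> T z (winvF u)) \<diamondop> (T z (\<phi> u) \<diamondop> T ?z (\<phi> v)) \<in> H"
      using H ginH inH by (rule subgroup.m_closed)
    then show ?thesis
      using that z av n by (simp add: A.m_assoc T_mem T_mult T_mult' T_Nil)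
  qed
qed

end

section \<open>The five generators\<close>

locale aut_order_k = free_group_rank +
  fixes k :: nat
  assumes k5: "k \<ge> 5" and nk: "n \<ge> 2 * (k - 1)"
begin

text \<open>The largest number of \<open>k\<close>-cycles that leaves a generator fixed, so that
  this generator can absorb the sign.\<close>

definition numB :: nat where "numB = (n - 1) div k"

text \<open>The generator 2 takes the possible sign, which keeps the generators 0 and 1 fixed
  together with their signs.\<close>

definition ga where "ga = cycle_aut k (n - k) 1 2"
definition gb where "gb = cycle_aut k 0 numB (n - 1)"
definition gc where "gc = cycle_aut k 1 numB 0"

definition P :: "nat \<Rightarrow> letter" where "P i = (n - k + i, True)"
definition P' :: "nat \<Rightarrow> letter" where "P' i = (n - k + i, False)"

definition tau where "tau = T (0, True) [P 0] \<diamondop> T (0, False) [P 2]"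
definition sigma where "sigma = T (P' 0) [(1, True)]"

text \<open>At least three generators precede the last \<open>k\<close>, so 0, 1 and 2 lie outside
  the cycle of \<open>ga\<close>.\<close>

lemma sizes: "n - k \<ge> 3" "n \<ge> k" "n \<ge> 8" "k > 0"
  using k5 nk by auto

lemma numB: "numB * k \<le> n - 1" "n - 1 < numB * k + k" "numB > 0"
proof -
  show "numB * k \<le> n - 1" by (simp add: numB_def)
  show "n - 1 < numB * k + k"
    using div_mult_mod_eq[of "n - 1" k] mod_less_divisor[OF sizes(4), of "n - 1"] unfolding numB_def by linarith
  have "k \<le> n - 1" using k5 nk by simp
  then show "numB > 0" using sizes(4) by (simp add: numB_def div_greater_zero_iff)
qed

lemma ga_hyps: "n - k + 1 * k \<le> n" "(0::nat) < 1" "2 < n" "2 < n - k \<or> n - k + 1 * k \<le> 2"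
  using sizes by auto

lemma gb_hyps: "0 + numB * k \<le> n" "0 < numB" "n - 1 < n" "n - 1 < 0 \<or> 0 + numB * k \<le> n - 1"
  using sizes numB by auto

lemma gc_hyps: "1 + numB * k \<le> n" "0 < numB" "0 < n" "(0::nat) < 1 \<or> 1 + numB * k \<le> 0"
  using sizes numB by auto

lemmas ga_props = cycle_aut_props[OF sizes(4) ga_hyps, folded ga_def]
lemmas gb_props = cycle_aut_props[OF sizes(4) gb_hyps, folded gb_def]
lemmas gc_props = cycle_aut_props[OF sizes(4) gc_hyps, folded gc_def]

lemma ga_fix: "i < n - k \<Longrightarrow> i \<noteq> 2 \<Longrightarrow> ga [(i, b)] = [(i, b)]"
  using ga_props(4)[of i b] by (simp add: block_cycle_outside)

lemma ga_P: "i < k \<Longrightarrow> ga [(n - k + i, b)] = [(n - k + (i + 1) mod k, b)]"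
  using ga_props(4)[of "n - k + i" b] block_cycle_inside[of 0 1 i k "n - k"] sizes by simp

lemma P_simps [simp]: "inv_letter (P i) = P' i" "inv_letter (P' i) = P i" "fst (P i) = n - k + i" "fst (P' i) = n - k + i"
  "ga [P i] = [P ((i + 1) mod k)]" "ga [P' i] = [P' ((i + 1) mod k)]" if "i < k"
  using ga_P[OF that] by (simp_all add: P_def P'_def)

lemma tau_mem: "tau \<in> carrier A"
  using sizes k5 unfolding tau_def by (intro A.m_closed T_mem) auto

lemma sigma_mem: "sigma \<in> carrier A"
  using sizes k5 unfolding sigma_def by (intro T_mem) auto

lemma elementary_subset:
  assumes H: "subgroup H A" and mem: "ga \<in> H" "gb \<in> H" "gc \<in> H"
    "tau \<diamondop> ga \<diamondop> inv\<^bsub>A\<^esub> tau \<in> H" "sigma \<diamondop> ga \<diamondop> inv\<^bsub>A\<^esub> sigma \<in> H"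
  shows "elementary \<subseteq> H"
proof -
  define z z' w w' :: letter where "z = (0, True)" and "z' = (0, False)" and "w = (1, True)" and "w' = (1, False)"
  have zs: "fst z = 0" "fst z' = 0" "inv_letter z = z'" "inv_letter z' = z" "fst w = 1" "fst w' = 1"
    "inv_letter w = w'" "inv_letter w' = w"
    by (simp_all add: z_def z'_def w_def w'_def)
  have ga_fix': "ga [z] = [z]" "ga [z'] = [z']" "ga [w] = [w]" "ga [w'] = [w']"
    using ga_fix sizes by (auto simp: z_def z'_def w_def w'_def)
  have Hinv: "x \<in> H \<Longrightarrow> inv\<^bsub>A\<^esub> x \<in> H" and Hm: "x \<in> H \<Longrightarrow> y \<in> H \<Longrightarrow> x \<diamondop> y \<in> H" for x y
    using H by (simp_all add: subgroup.m_inv_closed subgroup.m_closed)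
  note A1 = ga_props(1) and le = ga_props(2)
  have nP: "n - k + i < n" if "i < k" for i using that sizes by simp
  have conjT: "ga \<diamondop> T l [m] \<diamondop> inv\<^bsub>A\<^esub> ga = T l' [m']"
    if "ga [l] = [l']" "ga [m] = [m']" "avoids l [m]" for l m l' m'
    using lettery_conj(2)[OF A1 le that(1,3)] that(2) by simp
  have conj_inv: "ga \<diamondop> inv\<^bsub>A\<^esub> x \<diamondop> inv\<^bsub>A\<^esub> ga = inv\<^bsub>A\<^esub> (ga \<diamondop> x \<diamondop> inv\<^bsub>A\<^esub> ga)" if "x \<in> carrier A" for x
    using A1 that by (simp add: A.inv_mult_group A.m_assoc)
  have conj_mult: "ga \<diamondop> (x \<diamondop> y) \<diamondop> inv\<^bsub>A\<^esub> ga = (ga \<diamondop> x \<diamondop> inv\<^bsub>A\<^esub> ga) \<diamondop> (ga \<diamondop> y \<diamondop> inv\<^bsub>A\<^esub> ga)"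
    if "x \<in> carrier A" "y \<in> carrier A" for x y
  proof -
    have "inv\<^bsub>A\<^esub> ga \<diamondop> (ga \<diamondop> r) = r" if "r \<in> carrier A" for r
      using A1 that by (simp flip: A.m_assoc)
    then show ?thesis using A1 that by (simp add: A.m_assoc)
  qed
  \<comment> \<open>Dividing a conjugate of \<open>ga\<close> by \<open>ga\<close> gives
    \<open>x\<close> times the inverse of its own conjugate, in which \<open>ga\<close> only shifts
    the indices of the transvections that make up \<open>x\<close>.\<close>
  have quot: "x \<diamondop> ga \<diamondop> inv\<^bsub>A\<^esub> x \<diamondop> inv\<^bsub>A\<^esub> ga = x \<diamondop> inv\<^bsub>A\<^esub> (ga \<diamondop> x \<diamondop> inv\<^bsub>A\<^esub> ga)" if "x \<in> carrier A" for x
    using A1 that by (simp add: A.inv_mult_group A.m_assoc)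
  define u v where "u = [P 0] \<cdot> [P' 1]" and "v = [P 2] \<cdot> [P' 3]"
  have avzP: "avoids z [P i]" "avoids z [P' i]" "avoids z' [P i]" "avoids z' [P' i]" if "i < k" for i
    using that nP[OF that] sizes by (auto simp: zs)
  have kk: "0 < k" "1 < k" "2 < k" "3 < k" "4 < k" "k - 1 < k" using k5 by auto
  have avuv: "avoids z u" "avoids z v" unfolding u_def v_def using avzP kk by (blast intro: avoids_mult)+
  note nPs = nP[OF kk(1)] nP[OF kk(2)] nP[OF kk(3)] nP[OF kk(4)]
  note av = avzP[OF kk(1)] avzP[OF kk(2)] avzP[OF kk(3)] avzP[OF kk(4)]
  note TA = av[THEN T_mem]
  have g: "T z u \<diamondop> T (inv_letter z) v \<in> H"
  proof -
    have tau: "tau = T z [P 0] \<diamondop> T z' [P 2]" by (simp add: tau_def z_def z'_def)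
    have c: "ga \<diamondop> T z [P 0] \<diamondop> inv\<^bsub>A\<^esub> ga = T z [P 1]" "ga \<diamondop> T z' [P 2] \<diamondop> inv\<^bsub>A\<^esub> ga = T z' [P 3]"
      using conjT[of z z "P 0" "P 1"] conjT[of z' z' "P 2" "P 3"] av kk by (simp_all add: ga_fix')
    have "tau \<diamondop> ga \<diamondop> inv\<^bsub>A\<^esub> tau \<diamondop> inv\<^bsub>A\<^esub> ga = tau \<diamondop> inv\<^bsub>A\<^esub> (T z [P 1] \<diamondop> T z' [P 3])"
      unfolding quot[OF tau_mem] unfolding tau by (simp only: conj_mult TA c)
    also have "inv\<^bsub>A\<^esub> (T z [P 1] \<diamondop> T z' [P 3]) = T z' [P' 3] \<diamondop> T z [P' 1]"
      using T_inv[OF avzP(1)[OF kk(2)]] T_inv[OF avzP(3)[OF kk(4)]] TA kk nP[OF kk(2)] nP[OF kk(4)] by (simp add: A.inv_mult_group)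
    also have "tau \<diamondop> (T z' [P' 3] \<diamondop> T z [P' 1]) = T z [P 0] \<diamondop> (T z' v \<diamondop> T z [P' 1])"
      unfolding tau v_def by (simp only: A.m_assoc TA A.m_closed T_mult' av)
    also have "T z' v \<diamondop> T z [P' 1] = T z [P' 1] \<diamondop> T z' v"
      using T_comm[of z "[P' 1]" v] avzP[OF kk(2)] avuv by (simp add: zs)
    also have "T z [P 0] \<diamondop> (T z [P' 1] \<diamondop> T z' v) = T z u \<diamondop> T z' v"
      unfolding u_def using av avuv(2) avoids_inv_letter[of z v] zs(3) by (intro T_mult' T_mem) simp_all
    finally show ?thesis using mem(4,1) Hm Hinv by (metis zs(3))
  qed
  have avPw: "avoids (P i) [w]" "avoids (P i) [w']" "avoids (P' i) [w]" "avoids (P' i) [w']" if "i < k" for i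
    using that nP[OF that] sizes by (auto simp: zs)
  \<comment> \<open>It maps \<open>P i\<close> to \<open>w\<^sup>-\<^sup>1\<close> times itself and
    the cyclically next one to \<open>w\<close> times itself. \<open>h 0\<close> is the quotient
    that comes from \<open>sigma\<close>, and conjugation by \<open>ga\<close> shifts the
    index.\<close>
  define h where "h i = T (P' i) [w] \<diamondop> T (P' ((i + 1) mod k)) [w']" for i
  have h: "h i \<in> H" if "i < k" for i
    using that
  proof (induction i)
    case 0
    have s: "sigma = T (P' 0) [w]" by (simp add: sigma_def w_def)
    have c: "ga \<diamondop> T (P' 0) [w] \<diamondop> inv\<^bsub>A\<^esub> ga = T (P' 1) [w]"
      using conjT[of "P' 0" "P' 1" w w] avPw(3)[OF kk(1)] kk by (simp add: ga_fix')
    have "sigma \<diamondop> ga \<diamondop> inv\<^bsub>A\<^esub> sigma \<diamondop> inv\<^bsub>A\<^esub> ga = sigma \<diamondop> inv\<^bsub>A\<^esub> (T (P' 1) [w])"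
      unfolding quot[OF sigma_mem] unfolding s c ..
    also have "\<dots> = h 0"
      using T_inv[OF avPw(3)[OF kk(2)]] sizes kk by (simp add: h_def s zs)
    finally show ?case using mem(5,1) Hm Hinv by metis
  next
    case (Suc i)
    then have i: "i < k" "Suc i < k" "(i + 1) mod k = Suc i" "Suc (Suc i) mod k < k" by auto
    have c: "ga \<diamondop> T (P' i) [w] \<diamondop> inv\<^bsub>A\<^esub> ga = T (P' (Suc i)) [w]"
      "ga \<diamondop> T (P' (Suc i)) [w'] \<diamondop> inv\<^bsub>A\<^esub> ga = T (P' (Suc (Suc i) mod k)) [w']"
      using conjT[of "P' i" "P' (Suc i)" w w] conjT[of "P' (Suc i)" "P' (Suc (Suc i) mod k)" w' w']
        avPw(3)[OF i(1)] avPw(4)[OF i(2)] i by (simp_all add: ga_fix')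
    have "ga \<diamondop> h i \<diamondop> inv\<^bsub>A\<^esub> ga = h (Suc i)"
      unfolding h_def i(3) using T_mem[OF avPw(3)[OF i(1)]] T_mem[OF avPw(4)[OF i(2)]] by (simp add: conj_mult c)
    then show ?case using Suc mem(1) Hm Hinv i by (metis)
  qed
  have hA: "T (P' i) [w] \<in> carrier A" "T (P' i) [w'] \<in> carrier A" if "i < k" for i
    using avPw[OF that] by (auto intro: T_mem)
  have h_z: "h i [z] = [z]" "\<And>x. fst x < n \<Longrightarrow> fst x \<noteq> fst z \<Longrightarrow> avoids z (h i [x])" if i: "i < k" for i
  proof -
    have i': "(i + 1) mod k < k" using kk by simp
    show "h i [z] = [z]"
      unfolding h_def using hA[OF i] hA[OF i'] sizes T_letter(3)[OF avPw(3)[OF i], of z]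
        T_letter(3)[OF avPw(4)[OF i'], of z] i i' by (simp add: zs)
    fix x :: letter assume "fst x < n" "fst x \<noteq> fst z"
    then have "avoids z [x]" by (simp add: zs)
    moreover have "avoids z [w]" "avoids z [w']" using sizes by (auto simp: zs)
    ultimately have "avoids z (T (P' i) [w] (T (P' ((i + 1) mod k)) [w'] [x]))"
      using avPw[OF i] avPw[OF i'] by (intro T_avoids)
    then show "avoids z (h i [x])" unfolding h_def using hA[OF i] hA[OF i'] \<open>fst x < n\<close> by simp
  qed
  have h_fix: "h i [P j] = [P j]" "h i [P' j] = [P' j]" if "i < k" "j < k" "j \<noteq> i" "j \<noteq> (i + 1) mod k" for i j
    unfolding h_def using that hA nP[of j] kk T_letter(3)[OF avPw(3), of i "P j"] T_letter(3)[OF avPw(3), of i "P' j"]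
      T_letter(3)[OF avPw(4), of "(i + 1) mod k" "P j"] T_letter(3)[OF avPw(4), of "(i + 1) mod k" "P' j"]
    by simp_all
  have hmem: "h i \<in> carrier A" if "i < k" for i using h[OF that] H by (meson subgroup.mem_carrier)
  have wn: "fst w < n" "fst w' < n" using sizes by (auto simp: zs)
  have z_w: "T z [w] \<in> H"
  proof -
    \<comment> \<open>It moves only the letters with index \<open>k - 1\<close> and 0. As
      \<open>k - 1\<close> exceeds 3, it multiplies \<open>u\<close> by \<open>w\<close> on the left
      and fixes \<open>v\<close>.\<close>
    let ?h = "h (k - 1)"
    have hk: "?h = T (P' (k - 1)) [w] \<diamondop> T (P' 0) [w']" using kk by (simp add: h_def)
    have "T (P' 0) [w'] [P 0] = [w] \<cdot> [P 0]"
      using T_letter(2)[OF avPw(4)[OF kk(1)]] kk wn by (simp add: zs)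
    moreover have "T (P' (k - 1)) [w] [w] = [w]" "T (P' (k - 1)) [w] [P 0] = [P 0]"
      using T_letter(3)[OF avPw(3)[OF kk(6)], of w] T_letter(3)[OF avPw(3)[OF kk(6)], of "P 0"] sizes kk k5
      by (auto simp: zs)
    ultimately have "?h [P 0] = [w] \<cdot> [P 0]"
      unfolding hk using hA kk nPs wn by simp
    moreover have "?h [P' 1] = [P' 1]" "?h [P 2] = [P 2]" "?h [P' 3] = [P' 3]"
      using h_fix[of "k - 1"] kk k5 by auto
    ultimately have "?h u = [w] \<cdot> u" "?h v = v"
      unfolding u_def v_def using hmem[OF kk(6)] kk nPs wn by (simp_all add: F.m_assoc)
    then have "T z ([w] \<cdot> u \<cdot> winvF u) \<in> H"
      using commutator_step(1)[OF H avuv g h[OF kk(6)] h_z[OF kk(6)]] by simp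
    then show ?thesis using avoidsD[OF avuv(1)] wn by (simp add: F.m_assoc)
  qed
  have z'_w: "T z' [w] \<in> H"
  proof -
    \<comment> \<open>It moves only the letters with index 3 and 4, and 4 is an index different from
      0 because \<open>k \<ge> 5\<close>. So it fixes \<open>u\<close> and multiplies
      \<open>v\<close> by \<open>w\<close> on the right.\<close>
    let ?h = "h 3"
    have hk: "?h = T (P' 3) [w] \<diamondop> T (P' 4) [w']" using k5 by (simp add: h_def)
    have "T (P' 3) [w] [P' 3] = [P' 3] \<cdot> [w]" "T (P' 4) [w'] [P' 3] = [P' 3]"
      using T_letter(1)[OF avPw(3)[OF kk(4)]] T_letter(3)[OF avPw(4)[OF kk(5)], of "P' 3"] kk nP by simp_all
    then have "?h [P' 3] = [P' 3] \<cdot> [w]"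
      unfolding hk using hA kk nPs wn by simp
    moreover have "?h [P' 1] = [P' 1]" "?h [P 2] = [P 2]" "?h [P 0] = [P 0]"
      using h_fix[of 3] kk k5 by auto
    ultimately have "?h u = u" "?h v = v \<cdot> [w]"
      unfolding u_def v_def using hmem[OF kk(4)] kk nPs wn by (simp_all add: F.m_assoc)
    then have "T z' (winvF v \<cdot> (v \<cdot> [w])) \<in> H"
      using commutator_step(2)[OF H avuv g h[OF kk(4)] h_z[OF kk(4)]] by (simp add: zs)
    then show ?thesis using avoidsD[OF avuv(2)] wn by simp
  qed
  have l01: "linked H 0 1"
    unfolding linked_def using z_w z'_w sizes by (auto simp: z_def z'_def w_def) (metis (full_types))
  define eqv where "eqv i j \<longleftrightarrow> i = j \<or> linked H i j \<and> linked H j i" for i j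
  have eqv_trans: "eqv i p" if "eqv i j" "eqv j p" for i j p
    using that linked_trans[OF H] unfolding eqv_def by metis
  have linked_cycle: "linked H (block_cycle k s B i) (block_cycle k s B j)"
    if "linked H i j" "cycle_aut k s B d \<in> H" "s + B * k \<le> n" "0 < B" "d < n" "d < s \<or> s + B * k \<le> d" for i j s B d
  proof -
    note p = cycle_aut_props[OF sizes(4) that(3-6)]
    have "i < n" "j < n" using that(1) by (auto simp: linked_def)
    then obtain b c where "cycle_aut k s B d [(i, True)] = [(block_cycle k s B i, b)]"
      "cycle_aut k s B d [(j, True)] = [(block_cycle k s B j, c)]" using p(5) by meson
    then show ?thesis by (rule linked_image[OF H that(2) p(2) _ _ that(1)])
  qed
  have eqv_cycle: "eqv (block_cycle k s B i) (block_cycle k s B j)"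
    if "eqv i j" "cycle_aut k s B d \<in> H" "s + B * k \<le> n" "0 < B" "d < n" "d < s \<or> s + B * k \<le> d" for i j s B d
    using that linked_cycle unfolding eqv_def by metis
  note mem' = mem(1-3)[unfolded ga_def gb_def gc_def]
  have kB: "k \<le> numB * k" using numB(3) by simp
  have bnext: "block_cycle k 0 numB i = Suc i" if "i < k - 1" for i
  proof -
    have "i < 0 + numB * k" using that kB by linarith
    then show ?thesis using block_cycle_next[of 0 i numB k] that sizes by simp
  qed
  \<comment> \<open>Conjugation by \<open>gb\<close> moves the pair (0, 1) along the first
    block.\<close>
  have step: "linked H i (Suc i)" if "i < k - 1" for i
    using that
  proof (induction i)
    case (Suc i)
    then show ?case using linked_cycle[OF _ mem'(2) gb_hyps, of i "Suc i"] bnext[of i] bnext[of "Suc i"] by simp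
  qed (use l01 in simp)
  have up: "linked H 1 j" if "1 < j" "j < k" for j
    using that
  proof (induction j)
    case (Suc j)
    show ?case
    proof (cases "j = 1")
      case True
      then show ?thesis using step[of 1] Suc by simp
    next
      case False
      then show ?thesis using Suc step[of j] linked_trans[OF H, of 1 j "Suc j"] by simp
    qed
  qed simp
  \<comment> \<open>One more conjugation takes (k-2, k-1) to (k-1, 0). This closes the cycle, so 1
    is also linked to 0.\<close>
  have "linked H (k - 1) 0"
  proof -
    have "block_cycle k 0 numB (k - 1) = 0" using block_cycle_inside[of 0 numB "k - 1" k 0] numB kk by simp
    then show ?thesis
      using linked_cycle[OF _ mem'(2) gb_hyps, of "k - 2" "k - 1"] step[of "k - 2"] bnext[of "k - 2"] k5
      by (simp add: numeral_2_eq_2 Suc_diff_Suc)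
  qed
  then have "linked H 1 0" using up[of "k - 1"] linked_trans[OF H, of 1 "k - 1" 0] k5 by simp
  then have e10: "eqv 1 0" using l01 by (simp add: eqv_def)
  have all: "eqv i 0" if "i < n" for i
    using that
  proof (induction i)
    case (Suc m)
    then have IH: "eqv m 0" by simp
    \<comment> \<open>Inside a block of \<open>gb\<close>, this cycle moves \<open>m\<close> to its
      successor and 0 to 1. At the end of a block \<open>gc\<close>, whose blocks are shifted by
      one, moves \<open>m\<close> to its successor and fixes 0. Beyond the last block
      \<open>ga\<close> does so.\<close>
    consider "m = 0" | "0 < m" "m < numB * k" "m mod k \<noteq> k - 1" | "0 < m" "m < numB * k" "m mod k = k - 1"
      | "numB * k \<le> m" by linarith
    then show ?case
    proof cases
      case 1
      then show ?thesis using e10 by simp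
    next
      case 2
      then have "block_cycle k 0 numB m = Suc m" using block_cycle_next[of 0 m numB k] sizes by simp
      then have "eqv (Suc m) 1" using eqv_cycle[OF IH mem'(2) gb_hyps] bnext[of 0] k5 by simp
      then show ?thesis using e10 eqv_trans by blast
    next
      case 3
      have "(m - 1) mod k \<noteq> k - 1"
      proof
        assume *: "(m - 1) mod k = k - 1"
        have "Suc ((m - 1) mod k) = k" using * sizes by simp
        then have "m mod k = 0" using 3(1) by (metis Suc_pred' mod_Suc)
        then show False using 3(3) k5 by simp
      qed
      then have "block_cycle k 1 numB m = Suc m" using block_cycle_next[of 1 m numB k] 3 sizes by simp
      then show ?thesis using eqv_cycle[OF IH mem'(3) gc_hyps] by (simp add: block_cycle_outside)
    next
      case 4
      \<comment> \<open>At most \<open>k\<close> generators lie beyond the blocks of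
        \<open>gb\<close>, so all of them belong to the cycle of \<open>ga\<close>.\<close>
      then have m: "n - k \<le> m" "m - (n - k) < k - 1" using numB Suc.prems sizes by linarith+
      then have "(m - (n - k)) mod k \<noteq> k - 1" by simp
      then have "block_cycle k (n - k) 1 m = Suc m"
        using block_cycle_next[of "n - k" m 1 k] m Suc.prems sizes by simp
      then show ?thesis using eqv_cycle[OF IH mem'(1) ga_hyps] sizes by (simp add: block_cycle_outside)
    qed
  qed (simp add: eqv_def)
  show ?thesis
  proof
    fix x assume "x \<in> elementary"
    then obtain l m where x: "x = T l [m]" "fst l < n" "fst m < n" "fst l \<noteq> fst m"
      unfolding elementary_def by blast
    have "eqv 0 (fst m)" using all[OF x(3)] by (auto simp: eqv_def)
    then have "eqv (fst l) (fst m)" using all[OF x(2)] eqv_trans by blast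
    then show "x \<in> H" using x linkedD[OF H, of l m] by (simp add: eqv_def)
  qed
qed

end

section \<open>The quotients Out+ and SL(n,Z)\<close>

context free_group_rank
begin

lemma Aut_plus_eq: "Aut_plus n = A\<lparr>carrier := NG\<rparr>"
  by (simp add: Aut_plus_def NG_eq dt_def)

definition inner :: "letter list \<Rightarrow> letter list \<Rightarrow> letter list" where
  "inner g = (\<lambda>x\<in>carrier F. g \<cdot> x \<cdot> winvF g)"

lemma Inn_F_eq: "Inn_F n = inner ` carrier F"
  by (auto simp: Inn_F_def inner_def)

lemma inner_apply: "x \<in> carrier F \<Longrightarrow> inner g x = g \<cdot> x \<cdot> winvF g"
  by (simp add: inner_def)

lemma inner_mem:
  assumes g: "g \<in> carrier F"
  shows "inner g \<in> carrier A"
proof -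
  have "inner g \<in> hom F F"
    by (rule homI) (use g in \<open>auto simp: inner_apply F.m_assoc\<close>)
  moreover have "bij_betw (inner g) (carrier F) (carrier F)"
    by (rule bij_betw_byWitness[where f' = "inner (winvF g)"])
      (use g in \<open>auto simp: inner_apply F.m_assoc\<close>)
  ultimately show ?thesis by (simp add: mem_A inner_def)
qed

lemma M_inner:
  assumes "g \<in> carrier F"
  shows "M (inner g) = 1\<^sub>m n"
  using assms by (intro eq_matI) (auto simp: ab_mat_def inner_apply expsum_mult expsum_inv)

lemma inner_mult: "g \<in> carrier F \<Longrightarrow> h \<in> carrier F \<Longrightarrow> inner g \<diamondop> inner h = inner (g \<cdot> h)"
  by (rule A_eqI) (auto simp: inner_mem inner_apply F.m_assoc F.inv_mult_group)

lemma inner_one: "inner [] = \<one>\<^bsub>A\<^esub>"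
  by (rule A_eqI) (auto simp: inner_mem inner_apply)

lemma inner_inv: "g \<in> carrier F \<Longrightarrow> inv\<^bsub>A\<^esub> (inner g) = inner (winvF g)"
  by (rule A.inv_equality) (simp_all add: inner_mem inner_mult inner_one)

lemma inner_conj:
  assumes "\<phi> \<in> carrier A" "g \<in> carrier F"
  shows "\<phi> \<diamondop> inner g \<diamondop> inv\<^bsub>A\<^esub> \<phi> = inner (\<phi> g)"
proof -
  have "\<phi> \<diamondop> inner g = inner (\<phi> g) \<diamondop> \<phi>"
    using assms by (intro A_eqI) (auto simp: inner_mem inner_apply A_hom_inv)
  then show ?thesis using assms by (simp add: A.m_assoc inner_mem)
qed

lemma Inn_normal: "Inn_F n \<lhd> A"
proof (rule A.normal_invI)
  show "subgroup (Inn_F n) A"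
    unfolding Inn_F_eq
  proof (rule A.subgroupI)
    show "inner ` carrier F \<noteq> {}" using F_Nil by blast
    fix x assume "x \<in> inner ` carrier F"
    then show "inv\<^bsub>A\<^esub> x \<in> inner ` carrier F" by (auto simp: inner_inv)
    fix y assume "y \<in> inner ` carrier F"
    then show "x \<diamondop> y \<in> inner ` carrier F" using \<open>x \<in> inner ` carrier F\<close> by (auto simp: inner_mult)
  qed (auto simp: inner_mem)
  fix x h assume "x \<in> carrier A" "h \<in> Inn_F n"
  then show "x \<diamondop> h \<diamondop> inv\<^bsub>A\<^esub> x \<in> Inn_F n" by (auto simp: Inn_F_eq inner_conj)
qed

text \<open>Inner automorphisms act trivially on the abelianisation, so the determinant is constant
  on cosets.\<close>

lemma coset_dt:
  assumes "\<phi> \<in> carrier A" "\<psi> \<in> Inn_F n #>\<^bsub>A\<^esub> \<phi>"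
  shows "dt \<psi> = dt \<phi>"
proof -
  obtain g where "g \<in> carrier F" "\<psi> = inner g \<diamondop> \<phi>"
    using assms(2) by (auto simp: r_coset_def Inn_F_eq)
  then show ?thesis using assms(1) M_inner by (simp add: dt_mult inner_mem) (simp add: dt_def)
qed

text \<open>Since the determinant is constant on a coset, a condition on all its elements is a
  condition on one representative.\<close>

lemma Out_plus_eq: "Out_plus n = (Out_F n)\<lparr>carrier := (\<lambda>\<phi>. Inn_F n #>\<^bsub>A\<^esub> \<phi>) ` NG\<rparr>"
proof -
  have self: "\<phi> \<in> Inn_F n #>\<^bsub>A\<^esub> \<phi>" if "\<phi> \<in> carrier A" for \<phi>
    using A.rcos_self[OF that] Inn_normal by (simp add: normal_imp_subgroup)
  have "{C \<in> carrier (Out_F n). \<forall>\<phi>\<in>C. dt \<phi> = 1} = (\<lambda>\<phi>. Inn_F n #>\<^bsub>A\<^esub> \<phi>) ` NG"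
  proof (intro equalityI subsetI)
    fix C assume "C \<in> {C \<in> carrier (Out_F n). \<forall>\<phi>\<in>C. dt \<phi> = 1}"
    then obtain \<phi> where "\<phi> \<in> carrier A" "C = Inn_F n #>\<^bsub>A\<^esub> \<phi>" "\<forall>\<phi>\<in>C. dt \<phi> = 1"
      unfolding Out_F_def carrier_FactGroup by blast
    then show "C \<in> (\<lambda>\<phi>. Inn_F n #>\<^bsub>A\<^esub> \<phi>) ` NG" using self unfolding NG_eq by blast
  next
    fix C assume "C \<in> (\<lambda>\<phi>. Inn_F n #>\<^bsub>A\<^esub> \<phi>) ` NG"
    then obtain \<phi> where \<phi>: "\<phi> \<in> carrier A" "dt \<phi> = 1" "C = Inn_F n #>\<^bsub>A\<^esub> \<phi>"
      unfolding NG_eq by blast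
    then have "\<forall>\<psi>\<in>C. dt \<psi> = 1" using coset_dt by metis
    then show "C \<in> {C \<in> carrier (Out_F n). \<forall>\<phi>\<in>C. dt \<phi> = 1}"
      using \<phi> unfolding Out_F_def carrier_FactGroup by blast
  qed
  then show ?thesis by (simp add: Out_plus_def dt_def)
qed

text \<open>These are the hypotheses of \<open>order_k_quotient\<close>; the last one holds because
  the kernel consists of inner automorphisms.\<close>

lemma Out_plus_hom:
  "group (Out_plus n)" "(\<lambda>\<phi>. Inn_F n #>\<^bsub>A\<^esub> \<phi>) \<in> hom (Aut_plus n) (Out_plus n)"
  "(\<lambda>\<phi>. Inn_F n #>\<^bsub>A\<^esub> \<phi>) ` carrier (Aut_plus n) = carrier (Out_plus n)"
  "\<And>\<phi>. \<phi> \<in> carrier (Aut_plus n) \<Longrightarrow> Inn_F n #>\<^bsub>A\<^esub> \<phi> = \<one>\<^bsub>Out_plus n\<^esub> \<Longrightarrow> M \<phi> = 1\<^sub>m n"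
proof -
  interpret I: normal "Inn_F n" A by (rule Inn_normal)
  have gO: "group (Out_F n)" unfolding Out_F_def by (rule I.factorgroup_is_group)
  have hom: "(\<lambda>\<phi>. Inn_F n #>\<^bsub>A\<^esub> \<phi>) \<in> hom A (Out_F n)"
    unfolding Out_F_def by (rule I.r_coset_hom_Mod)
  interpret h: group_hom A "Out_F n" "\<lambda>\<phi>. Inn_F n #>\<^bsub>A\<^esub> \<phi>"
    using hom gO by (simp add: group_hom_def group_hom_axioms_def)
  have "subgroup ((\<lambda>\<phi>. Inn_F n #>\<^bsub>A\<^esub> \<phi>) ` NG) (Out_F n)"
    by (rule h.subgroup_img_is_subgroup[OF NG_subgroup])
  then show "group (Out_plus n)"
    unfolding Out_plus_eq using gO by (rule subgroup.subgroup_is_group)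
  show "(\<lambda>\<phi>. Inn_F n #>\<^bsub>A\<^esub> \<phi>) \<in> hom (Aut_plus n) (Out_plus n)"
    using h.hom_mult by (intro homI) (auto simp: Aut_plus_eq Out_plus_eq NG_eq)
  show "(\<lambda>\<phi>. Inn_F n #>\<^bsub>A\<^esub> \<phi>) ` carrier (Aut_plus n) = carrier (Out_plus n)"
    by (simp add: Aut_plus_eq Out_plus_eq)
  fix \<phi> assume \<phi>: "\<phi> \<in> carrier (Aut_plus n)" "Inn_F n #>\<^bsub>A\<^esub> \<phi> = \<one>\<^bsub>Out_plus n\<^esub>"
  have "\<phi> \<in> Inn_F n"
    using \<phi> A.rcos_self[OF _ I.subgroup_axioms, of \<phi>]
    by (auto simp: Aut_plus_eq Out_plus_eq NG_eq Out_F_def)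
  then show "M \<phi> = 1\<^sub>m n" by (auto simp: Inn_F_eq M_inner)
qed

lemma SL_hom:
  "group (SL_Z n)" "M \<in> hom (Aut_plus n) (SL_Z n)" "M ` carrier (Aut_plus n) = carrier (SL_Z n)"
proof -
  have cSL: "B \<in> carrier (SL_Z n) \<longleftrightarrow> B \<in> carrier_mat n n \<and> det B = 1" for B
    by (simp add: SL_Z_def)
  show im: "M ` carrier (Aut_plus n) = carrier (SL_Z n)"
  proof (intro equalityI subsetI)
    fix B assume "B \<in> carrier (SL_Z n)"
    then obtain \<phi> where "\<phi> \<in> carrier A" "dt \<phi> = 1" "M \<phi> = B" using SL_image cSL by blast
    then show "B \<in> M ` carrier (Aut_plus n)" by (auto simp: Aut_plus_eq NG_eq)
  qed (auto simp: Aut_plus_eq NG_eq cSL dt_def)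
  show "M \<in> hom (Aut_plus n) (SL_Z n)"
    using im by (intro homI) (auto simp: Aut_plus_eq NG_eq M_mult SL_Z_def)
  show "group (SL_Z n)"
  proof (rule groupI)
    fix x assume "x \<in> carrier (SL_Z n)"
    \<comment> \<open>Inverse matrices come from inverting a lift to the automorphism group.\<close>
    then obtain \<phi> where \<phi>: "\<phi> \<in> carrier A" "dt \<phi> = 1" "x = M \<phi>"
      using im by (auto simp: Aut_plus_eq NG_eq)
    then have "M (inv\<^bsub>A\<^esub> \<phi>) \<in> carrier (SL_Z n)" "M (inv\<^bsub>A\<^esub> \<phi>) * x = 1\<^sub>m n"
      using dt_inv[OF \<phi>(1)] by (auto simp: cSL dt_def M_one simp flip: M_mult)
    then show "\<exists>y\<in>carrier (SL_Z n). y \<otimes>\<^bsub>SL_Z n\<^esub> x = \<one>\<^bsub>SL_Z n\<^esub>"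
      by (intro bexI[of _ "M (inv\<^bsub>A\<^esub> \<phi>)"]) (simp_all add: SL_Z_def)
  qed (auto simp: SL_Z_def det_mult[of _ n] assoc_mult_mat[of _ n n _ n _ n])
qed

end

section \<open>Orders and generating sets in the quotients\<close>

context aut_order_k
begin

definition gens :: "(letter list \<Rightarrow> letter list) set" where
  "gens = {ga, tau \<diamondop> ga \<diamondop> inv\<^bsub>A\<^esub> tau, sigma \<diamondop> ga \<diamondop> inv\<^bsub>A\<^esub> sigma, gb, gc}"

lemma gens_NG: "gens \<subseteq> NG"
  using ga_props(1,3) gb_props(1,3) gc_props(1,3) tau_mem sigma_mem dt_inv_mult
  by (auto simp: gens_def NG_eq dt_mult mult.commute mult.left_commute)

lemma generate_gens: "generate A gens = NG"
proof
  show "generate A gens \<subseteq> NG" by (rule A.generate_subgroup_incl[OF gens_NG NG_subgroup])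
  have "subgroup (generate A gens) A"
    using gens_NG NG_subgroup by (meson A.generate_is_subgroup order_trans subgroup.subset)
  moreover from this have "elementary \<subseteq> generate A gens"
    by (rule elementary_subset) (auto intro: generate.incl simp: gens_def)
  ultimately show "NG \<subseteq> generate A gens" by (intro A.generate_subgroup_incl)
qed

lemma conj_order:
  assumes "x \<in> carrier A" "y \<in> carrier A" "y [^]\<^bsub>A\<^esub> k = \<one>\<^bsub>A\<^esub>" "\<And>j::nat. M (y [^]\<^bsub>A\<^esub> j) = 1\<^sub>m n \<Longrightarrow> k dvd j"
  shows "(x \<diamondop> y \<diamondop> inv\<^bsub>A\<^esub> x) [^]\<^bsub>A\<^esub> k = \<one>\<^bsub>A\<^esub>" "\<And>j::nat. M ((x \<diamondop> y \<diamondop> inv\<^bsub>A\<^esub> x) [^]\<^bsub>A\<^esub> j) = 1\<^sub>m n \<Longrightarrow> k dvd j"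
proof -
  show "(x \<diamondop> y \<diamondop> inv\<^bsub>A\<^esub> x) [^]\<^bsub>A\<^esub> k = \<one>\<^bsub>A\<^esub>"
    using assms by (simp add: A.conj_pow)
  fix j :: nat assume *: "M ((x \<diamondop> y \<diamondop> inv\<^bsub>A\<^esub> x) [^]\<^bsub>A\<^esub> j) = 1\<^sub>m n"
  define z where "z = x \<diamondop> y [^]\<^bsub>A\<^esub> j \<diamondop> inv\<^bsub>A\<^esub> x"
  have zA: "z \<in> carrier A" and z1: "M z = 1\<^sub>m n"
    using * assms by (simp_all add: A.conj_pow z_def)
  have "inv\<^bsub>A\<^esub> x \<diamondop> (x \<diamondop> r) = r" if "r \<in> carrier A" for r
    using assms that by (simp flip: A.m_assoc)
  then have "y [^]\<^bsub>A\<^esub> j = inv\<^bsub>A\<^esub> x \<diamondop> z \<diamondop> x" using assms by (simp add: A.m_assoc z_def)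
  then have "M (y [^]\<^bsub>A\<^esub> j) = M (inv\<^bsub>A\<^esub> x) * M z * M x" using assms zA by (simp add: M_mult)
  also have "M (inv\<^bsub>A\<^esub> x) * M z * M x = 1\<^sub>m n"
    unfolding z1 using assms by (simp flip: M_mult) (simp add: M_one)
  finally show "k dvd j" by (rule assms(4))
qed

lemma gens_order:
  assumes "x \<in> gens"
  shows "x [^]\<^bsub>A\<^esub> k = \<one>\<^bsub>A\<^esub>" "\<And>j::nat. M (x [^]\<^bsub>A\<^esub> j) = 1\<^sub>m n \<Longrightarrow> k dvd j"
  using assms ga_props(6,7) gb_props(6,7) gc_props(6,7)
    conj_order[OF tau_mem ga_props(1,6,7)] conj_order[OF sigma_mem ga_props(1,6,7)]
  unfolding gens_def by blast+

text \<open>The \<open>k\<close>-th powers of the generators are trivial already in the automorphism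
  group. A trivial power in \<open>K\<close> is trivial on the abelianisation by the condition on
  the kernel, so its exponent is divisible by \<open>k\<close>. Images can coincide, which only
  lowers the cardinality.\<close>

lemma order_k_quotient:
  fixes K :: "('c, 'd) monoid_scheme"
  assumes K: "group K" and h: "h \<in> hom (Aut_plus n) K" "h ` carrier (Aut_plus n) = carrier K"
    and ker: "\<And>\<phi>. \<phi> \<in> carrier (Aut_plus n) \<Longrightarrow> h \<phi> = \<one>\<^bsub>K\<^esub> \<Longrightarrow> M \<phi> = 1\<^sub>m n"
  shows "gen_by_order K k \<and> d_k k K \<le> 5"
proof -
  have AP: "group (Aut_plus n)"
    unfolding Aut_plus_eq using A.is_group by (rule subgroup.subgroup_is_group[OF NG_subgroup])
  interpret h: group_hom "Aut_plus n" K h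
    using K h AP by (simp add: group_hom_def group_hom_axioms_def)
  have sub: "gens \<subseteq> carrier (Aut_plus n)" using gens_NG by (simp add: Aut_plus_eq)
  have pow: "x [^]\<^bsub>Aut_plus n\<^esub> (j::nat) = x [^]\<^bsub>A\<^esub> j" for x j
    unfolding Aut_plus_eq by (rule A.nat_pow_consistent[symmetric])
  have ord: "group.ord K (h x) = k" if x: "x \<in> gens" for x
  proof -
    have xc: "x \<in> carrier (Aut_plus n)" using sub x by blast
    have hp: "h x [^]\<^bsub>K\<^esub> j = h (x [^]\<^bsub>A\<^esub> j)" for j :: nat
      using h.hom_nat_pow[OF xc, of j] by (simp add: pow)
    have mem: "x [^]\<^bsub>A\<^esub> j \<in> carrier (Aut_plus n)" for j :: nat
      using h.G.nat_pow_closed[OF xc, of j] by (simp add: pow)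
    have one: "h \<one>\<^bsub>A\<^esub> = \<one>\<^bsub>K\<^esub>" using h.hom_one by (simp add: Aut_plus_eq)
    have hk: "h x [^]\<^bsub>K\<^esub> k = \<one>\<^bsub>K\<^esub>" using gens_order(1)[OF x] one by (simp add: hp)
    have "h x [^]\<^bsub>K\<^esub> j = \<one>\<^bsub>K\<^esub> \<longleftrightarrow> k dvd j" for j :: nat
    proof
      assume "h x [^]\<^bsub>K\<^esub> j = \<one>\<^bsub>K\<^esub>"
      then show "k dvd j" using gens_order(2)[OF x] ker[OF mem] by (simp add: hp)
    next
      assume "k dvd j"
      then obtain c where "j = k * c" ..
      then show "h x [^]\<^bsub>K\<^esub> j = \<one>\<^bsub>K\<^esub>"
        using hk xc by (simp flip: h.H.nat_pow_pow)
    qed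
    then show ?thesis using h.H.ord_unique[of "h x" k] xc by simp
  qed
  have "generate K (h ` gens) = h ` generate (Aut_plus n) gens"
    by (rule h.generate_img[OF sub])
  also have "generate (Aut_plus n) gens = carrier (Aut_plus n)"
    unfolding Aut_plus_eq by (simp add: A.generate_consistent[OF gens_NG NG_subgroup] generate_gens)
  finally have gen: "generate K (h ` gens) = carrier K" using h(2) by simp
  have fin: "finite gens" "card gens \<le> 5"
    unfolding gens_def by (simp_all add: card_insert_if)
  have mem: "h ` gens \<in> order_k_gensets K k"
    using sub ord gen fin(1) h.hom_closed by (auto simp: order_k_gensets_def)
  have "d_k k K \<le> card (h ` gens)"
    unfolding d_k_def by (rule Least_le) (use mem in blast)
  also have "\<dots> \<le> 5" using card_image_le[OF fin(1), of h] fin(2) by simp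
  finally show ?thesis using mem by (auto simp: gen_by_order_def)
qed

lemma Aut_plus_order_k: "gen_by_order (Aut_plus n) k \<and> d_k k (Aut_plus n) \<le> 5"
proof (rule order_k_quotient[of _ "\<lambda>x. x"])
  show "group (Aut_plus n)"
    unfolding Aut_plus_eq using A.is_group by (rule subgroup.subgroup_is_group[OF NG_subgroup])
qed (auto simp: hom_def Aut_plus_eq M_one)

end

theorem theorem1p2:
  fixes n k :: nat
  assumes "k \<ge> 5" and "n \<ge> 2 * (k - 1)"
  shows "(gen_by_order (Aut_plus n) k \<and> d_k k (Aut_plus n) \<le> 6
          \<and> (k \<ge> 6 \<and> n \<ge> 2 * k \<longrightarrow> d_k k (Aut_plus n) \<le> 5))
       \<and> (gen_by_order (Out_plus n) k \<and> d_k k (Out_plus n) \<le> 6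
          \<and> (k \<ge> 6 \<and> n \<ge> 2 * k \<longrightarrow> d_k k (Out_plus n) \<le> 5))
       \<and> (gen_by_order (SL_Z n) k \<and> d_k k (SL_Z n) \<le> 6
          \<and> (k \<ge> 6 \<and> n \<ge> 2 * k \<longrightarrow> d_k k (SL_Z n) \<le> 5))"
proof -
  interpret aut_order_k n k by unfold_locales (use assms in auto)
  have "gen_by_order (Out_plus n) k \<and> d_k k (Out_plus n) \<le> 5"
    by (rule order_k_quotient[OF Out_plus_hom])
  moreover have "gen_by_order (SL_Z n) k \<and> d_k k (SL_Z n) \<le> 5"
    by (rule order_k_quotient[OF SL_hom]) (simp add: SL_Z_def)
  ultimately show ?thesis using Aut_plus_order_k by auto
qed

end
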